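(* Let $\mathbf Y=\mathbf H(\mathcal Z,\mathbf Y)$ be a well-founded system with $\mathbf H$ an analytic species, and let $\boldsymbol H(z,\boldsymbol y)$ be the exponential generating series of $\mathbf H$. Let $\alpha$ be inside the disk of convergence of the exponential generating series $\boldsymbol S(z)$ of the solution species $\mathbf S$. Then the iteration $$\boldsymbol y^{[n+1]}=\boldsymbol y^{[n]}+\Big(\mathrm{Id}-\frac{\partial\boldsymbol H}{\partial\boldsymbol Y}(\alpha,\boldsymbol y^{[n]})\Big)^{-1}\big(\boldsymbol H(\alpha,\boldsymbol y^{[n]})-\boldsymbol y^{[n]}\big),\qquad\boldsymbol y^{[0]}=\mathbf 0,$$ converges to $\boldsymbol S(\alpha)$.
   Context: Species: functorial assignments of finite sets of structures to tuples of finite sets, up to isomorphism, with standard sum, product, composition. \emph{Well founded}: the iteration $\mathbf Y^{[0]}=\mathbf 0$, $\mathbf Y^{[n+1]}=\mathbf H(\mathcal Z,\mathbf Y^{[n]})$ is well defined (composition with species having structures on the empty set allowed only in sorts where $\mathbf H$ has finitely many structures of each total size in the other sorts), converges (for every $p$, eventually isomorphic to the limit on structures of size $\le p$), and its limit $\mathbf S$ (the solution) has no empty coordinate. The exponential generating series of a multisort species $\mathcal F$ is $\sum_{\mathbf n}f_{\mathbf n}\mathbf z^{\mathbf n}/\mathbf n!$, $f_{\mathbf n}$ the number of structures on $(\{1..n_1\},\dots,\{1..n_k\})$. A species is \emph{analytic} if its exponential generating series is analytic in a neighborhood of $\mathbf 0$.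
   Formalization: "Well defined" also requires that in each composition H(Z,Y^[n]) no structure has a non-trivial automorphism permuting its (empty) blocks; otherwise the claim fails, e.g. Y1=1, Y2=E_2(Y1) has S=(1,1) but Newton tends to (1,1/2). *)

theory Defs
  imports "HOL-Analysis.Analysis"
begin

text \<open>
  Multisort species. The sorts are the elements of a finite type \<open>'s\<close>, the labels are natural
  numbers (the finite subsets of \<open>nat\<close> form a category equivalent to that of all finite sets), and
  the structures are elements of an arbitrary type \<open>'x\<close>. A tuple of bijections with source \<open>U\<close> is
  given by functions \<open>\<sigma> s\<close> that are injective on \<open>U s\<close>; its target is \<open>\<lambda>s. \<sigma> s ` U s\<close>.
\<close>

record ('s, 'x) species =
  structs :: "('s \<Rightarrow> nat set) \<Rightarrow> 'x set"
  transport :: "('s \<Rightarrow> nat set) \<Rightarrow> ('s \<Rightarrow> nat \<Rightarrow> nat) \<Rightarrow> 'x \<Rightarrow> 'x"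

definition fin_tuple :: "('s \<Rightarrow> nat set) \<Rightarrow> bool" where
  "fin_tuple U \<longleftrightarrow> (\<forall>s. finite (U s))"

definition inj_tuple :: "('s \<Rightarrow> nat set) \<Rightarrow> ('s \<Rightarrow> nat \<Rightarrow> nat) \<Rightarrow> bool" where
  "inj_tuple U \<sigma> \<longleftrightarrow> (\<forall>s. inj_on (\<sigma> s) (U s))"

definition img_tuple :: "('s \<Rightarrow> nat \<Rightarrow> nat) \<Rightarrow> ('s \<Rightarrow> nat set) \<Rightarrow> ('s \<Rightarrow> nat set)" where
  "img_tuple \<sigma> U = (\<lambda>s. \<sigma> s ` U s)"

definition is_species :: "('s::finite, 'x) species \<Rightarrow> bool" where
  "is_species F \<longleftrightarrow>
     (\<forall>U. fin_tuple U \<longrightarrow> finite (structs F U)) \<and>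
     (\<forall>U \<sigma> x. fin_tuple U \<and> inj_tuple U \<sigma> \<and> x \<in> structs F U \<longrightarrow>
        transport F U \<sigma> x \<in> structs F (img_tuple \<sigma> U)) \<and>
     (\<forall>U \<sigma> x. fin_tuple U \<and> x \<in> structs F U \<and> (\<forall>s. \<forall>u\<in>U s. \<sigma> s u = u) \<longrightarrow>
        transport F U \<sigma> x = x) \<and>
     (\<forall>U \<sigma> \<tau> x. fin_tuple U \<and> inj_tuple U \<sigma> \<and> inj_tuple (img_tuple \<sigma> U) \<tau> \<and> x \<in> structs F U \<longrightarrow>
        transport F (img_tuple \<sigma> U) \<tau> (transport F U \<sigma> x) = transport F U (\<lambda>s. \<tau> s \<circ> \<sigma> s) x)"

text \<open>Natural isomorphism of the restrictions of two species to a class \<open>P\<close> of tuples.\<close>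

definition iso_on ::
    "(('s::finite \<Rightarrow> nat set) \<Rightarrow> bool) \<Rightarrow> ('s, 'x) species \<Rightarrow> ('s, 'y) species \<Rightarrow> bool" where
  "iso_on P F G \<longleftrightarrow>
     (\<exists>\<phi>. \<forall>U. fin_tuple U \<and> P U \<longrightarrow>
        bij_betw (\<phi> U) (structs F U) (structs G U) \<and>
        (\<forall>\<sigma> x. inj_tuple U \<sigma> \<and> x \<in> structs F U \<longrightarrow>
           \<phi> (img_tuple \<sigma> U) (transport F U \<sigma> x) = transport G U \<sigma> (\<phi> U x)))"

definition species_iso :: "('s::finite, 'x) species \<Rightarrow> ('s, 'y) species \<Rightarrow> bool" where
  "species_iso F G \<longleftrightarrow> iso_on (\<lambda>_. True) F G"

definition species_iso_upto :: "nat \<Rightarrow> ('s::finite, 'x) species \<Rightarrow> ('s, 'y) species \<Rightarrow> bool" where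
  "species_iso_upto p F G \<longleftrightarrow> iso_on (\<lambda>U. (\<Sum>s\<in>UNIV. card (U s)) \<le> p) F G"

definition empty_species :: "('s, 'x) species \<Rightarrow> bool" where
  "empty_species F \<longleftrightarrow> (\<forall>U. fin_tuple U \<longrightarrow> structs F U = {})"

definition zero_species :: "('s, 'x) species" where
  "zero_species = \<lparr>structs = (\<lambda>U. {}), transport = (\<lambda>U \<sigma> x. x)\<rparr>"

definition singleton_species :: "(unit, nat) species" where
  "singleton_species = \<lparr>structs = (\<lambda>U. {u. U () = {u}}), transport = (\<lambda>U \<sigma> u. \<sigma> () u)\<rparr>"

text \<open>
  Composition. An assembly \<open>(I, f, b)\<close> on \<open>U\<close> consists of finite sets \<open>I s\<close> of names of blocks of
  sort \<open>s\<close>, an \<open>F\<close>-structure \<open>f\<close> on these names, and for every name \<open>i \<in> I s\<close> a block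
  \<open>fst (b s i)\<close> with a \<open>G s\<close>-structure \<open>snd (b s i)\<close> on it, such that the blocks decompose \<open>U\<close>.
  Assemblies that differ only in the naming of the blocks are identified, which for non-empty blocks
  amounts to naming each block by itself, i.e. to \<open>F\<close>-structures on the set of blocks of a partition.
  The values of \<open>b s\<close> outside \<open>I s\<close> are irrelevant and are identified as well.
\<close>

type_synonym ('s, 'x, 't, 'y) assembly =
  "('s \<Rightarrow> nat set) \<times> 'x \<times> ('s \<Rightarrow> nat \<Rightarrow> ('t \<Rightarrow> nat set) \<times> 'y)"

definition assemblies ::
    "('s::finite, 'x) species \<Rightarrow> ('s \<Rightarrow> ('t::finite, 'y) species) \<Rightarrow> ('t \<Rightarrow> nat set)
       \<Rightarrow> ('s, 'x, 't, 'y) assembly set" where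
  "assemblies F G U = {(I, f, b).
     fin_tuple I \<and> f \<in> structs F I \<and>
     (\<forall>s. \<forall>i\<in>I s. snd (b s i) \<in> structs (G s) (fst (b s i))) \<and>
     (\<forall>t. U t = (\<Union>s. \<Union>i\<in>I s. fst (b s i) t)) \<and>
     (\<forall>t s s'. \<forall>i\<in>I s. \<forall>i'\<in>I s'. (s, i) \<noteq> (s', i') \<longrightarrow>
        fst (b s i) t \<inter> fst (b s' i') t = {})}"

definition renaming ::
    "('s::finite, 'x) species \<Rightarrow> ('s \<Rightarrow> nat \<Rightarrow> nat)
       \<Rightarrow> ('s, 'x, 't, 'y) assembly \<Rightarrow> ('s, 'x, 't, 'y) assembly \<Rightarrow> bool" where
  "renaming F \<sigma> = (\<lambda>(I, f, b) (I', f', b').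
     (\<forall>s. bij_betw (\<sigma> s) (I s) (I' s)) \<and> transport F I \<sigma> f = f' \<and>
     (\<forall>s. \<forall>i\<in>I s. b' s (\<sigma> s i) = b s i))"

definition same_assembly ::
    "('s::finite, 'x) species \<Rightarrow> (('s, 'x, 't, 'y) assembly \<times> ('s, 'x, 't, 'y) assembly) set" where
  "same_assembly F = {(a, a'). \<exists>\<sigma>. renaming F \<sigma> a a'}"

definition map_assembly ::
    "('s \<Rightarrow> ('t::finite, 'y) species) \<Rightarrow> ('t \<Rightarrow> nat \<Rightarrow> nat)
       \<Rightarrow> ('s, 'x, 't, 'y) assembly \<Rightarrow> ('s, 'x, 't, 'y) assembly" where
  "map_assembly G \<tau> = (\<lambda>(I, f, b).
     (I, f, \<lambda>s i. (img_tuple \<tau> (fst (b s i)), transport (G s) (fst (b s i)) \<tau> (snd (b s i)))))"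

definition compose ::
    "('s::finite, 'x) species \<Rightarrow> ('s \<Rightarrow> ('t::finite, 'y) species)
       \<Rightarrow> ('t, ('s, 'x, 't, 'y) assembly set) species" where
  "compose F G =
     \<lparr>structs = (\<lambda>U. assemblies F G U // same_assembly F),
      transport = (\<lambda>U \<tau> c. same_assembly F `` (map_assembly G \<tau> ` c))\<rparr>"

text \<open>
  The composition is always defined if no \<open>G s\<close> has structures on the empty set; both conditions
  below then hold automatically. In general, let \<open>J\<close> be the set of sorts \<open>s\<close> for which
  \<open>G s\<close> has structures on the empty set.

  \<^item> \<open>F\<close> must have finitely many structures (up to relabelling) of each total size in the sorts
    outside \<open>J\<close>.

  \<^item> No assembly may have a non-trivial automorphism: as in the case of non-empty blocks, the only
    renaming of the blocks that changes nothing is the identity. Otherwise no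
    species can play the role of the composite in the labelled setting: with \<open>E\<^sub>2\<close> the species of
    two-element sets, the composite of \<open>E\<^sub>2\<close> with the species \<open>1\<close> of the empty set would need the
    exponential generating series \<open>1/2\<close>, whereas it has one structure up to renaming.
\<close>

definition finite_in_other_sorts :: "'s set \<Rightarrow> ('s::finite, 'x) species \<Rightarrow> bool" where
  "finite_in_other_sorts J F \<longleftrightarrow>
     (\<forall>p. finite {n :: 's \<Rightarrow> nat. (\<Sum>s\<in>- J. n s) = p \<and> structs F (\<lambda>s. {1..n s}) \<noteq> {}})"

definition rigid_assemblies ::
    "('s::finite, 'x) species \<Rightarrow> ('s \<Rightarrow> ('t::finite, 'y) species) \<Rightarrow> bool" where
  "rigid_assemblies F G \<longleftrightarrow>
     (\<forall>U. fin_tuple U \<longrightarrow> (\<forall>a\<in>assemblies F G U. \<forall>\<sigma>.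
        renaming F \<sigma> a a \<longrightarrow> (\<forall>s. \<forall>i\<in>fst a s. \<sigma> s i = i)))"

definition composable ::
    "('s::finite, 'x) species \<Rightarrow> ('s \<Rightarrow> ('t::finite, 'y) species) \<Rightarrow> bool" where
  "composable F G \<longleftrightarrow>
     finite_in_other_sorts {s. structs (G s) (\<lambda>_. {}) \<noteq> {}} F \<and> rigid_assemblies F G"

text \<open>
  Systems \<open>Y = H(Z, Y)\<close>: the sort \<open>None\<close> is that of \<open>Z\<close>, the sort \<open>Some j\<close> that of \<open>Y\<^sub>j\<close>.
  Species are considered up to isomorphism, so the iterates can be taken with structures in \<open>nat\<close>.
\<close>

definition system_iteration ::
    "('m::finite \<Rightarrow> ('m option, 'x) species) \<Rightarrow> (nat \<Rightarrow> 'm \<Rightarrow> (unit, nat) species) \<Rightarrow> bool" where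
  "system_iteration H Y \<longleftrightarrow>
     (\<forall>n i. is_species (Y n i)) \<and>
     (\<forall>i. species_iso (Y 0 i) (zero_species :: (unit, nat) species)) \<and>
     (\<forall>n i. composable (H i) (case_option singleton_species (Y n)) \<and>
        species_iso (Y (Suc n) i) (compose (H i) (case_option singleton_species (Y n))))"

definition well_founded_system ::
    "('m::finite \<Rightarrow> ('m option, 'x) species) \<Rightarrow> ('m \<Rightarrow> (unit, 'y) species) \<Rightarrow> bool" where
  "well_founded_system H S \<longleftrightarrow>
     (\<forall>i. is_species (H i)) \<and> (\<forall>i. is_species (S i)) \<and>
     (\<exists>Y. system_iteration H Y \<and>
        (\<forall>p. eventually (\<lambda>n. \<forall>i. species_iso_upto p (Y n i) (S i)) sequentially)) \<and>
     (\<forall>i. \<not> empty_species (S i))"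

definition egs_coeff :: "('s::finite, 'x) species \<Rightarrow> ('s \<Rightarrow> nat) \<Rightarrow> complex" where
  "egs_coeff F n = of_nat (card (structs F (\<lambda>s. {1..n s}))) / (\<Prod>s\<in>UNIV. fact (n s))"

definition egs_term :: "('s::finite, 'x) species \<Rightarrow> ('s \<Rightarrow> complex) \<Rightarrow> ('s \<Rightarrow> nat) \<Rightarrow> complex" where
  "egs_term F x n = egs_coeff F n * (\<Prod>s\<in>UNIV. x s ^ n s)"

definition egs :: "('s::finite, 'x) species \<Rightarrow> ('s \<Rightarrow> complex) \<Rightarrow> complex" where
  "egs F x = (\<Sum>\<^sub>\<infinity>n. egs_term F x n)"

definition analytic_species :: "('s::finite, 'x) species \<Rightarrow> bool" where
  "analytic_species F \<longleftrightarrow>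
     (\<exists>e>0. \<forall>x. (\<forall>s. cmod (x s) < e) \<longrightarrow> egs_term F x summable_on UNIV)"

definition system_egs ::
    "('m::finite \<Rightarrow> ('m option, 'x) species) \<Rightarrow> complex \<Rightarrow> complex ^ 'm \<Rightarrow> complex ^ 'm" where
  "system_egs H z y = (\<chi> i. egs (H i) (case_option z (\<lambda>j. y $ j)))"

definition system_jacobian ::
    "('m::finite \<Rightarrow> ('m option, 'x) species) \<Rightarrow> complex \<Rightarrow> complex ^ 'm \<Rightarrow> complex ^ 'm ^ 'm" where
  "system_jacobian H z y =
     (\<chi> i j. deriv (\<lambda>t. system_egs H z (\<chi> k. if k = j then t else y $ k) $ i) (y $ j))"

primrec newton ::
    "('m::finite \<Rightarrow> ('m option, 'x) species) \<Rightarrow> complex \<Rightarrow> nat \<Rightarrow> complex ^ 'm" where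
  "newton H \<alpha> 0 = 0"
| "newton H \<alpha> (Suc n) = newton H \<alpha> n +
     matrix_inv (mat 1 - system_jacobian H \<alpha> (newton H \<alpha> n)) *v
       (system_egs H \<alpha> (newton H \<alpha> n) - newton H \<alpha> n)"

end

theory Submission
  imports Defs
begin

text \<open>
  Since \<open>S = H(Z, S)\<close> has non-negative coefficients, \<open>H\<close> converges at \<open>(\<rho>, S(\<rho>))\<close> for every \<open>\<rho>\<close> below the
  radius of convergence of \<open>S\<close>, and the Picard iterates \<open>Y n\<close> evaluated at \<open>\<rho>\<close> increase to \<open>S(\<rho>)\<close>.
  With \<open>\<rho> = \<bar>\<alpha>\<bar>\<close>, the real Newton iteration at \<open>\<rho>\<close> increases, stays below \<open>S(\<rho>)\<close> and majorizes the
  complex one: coefficientwise positivity bounds the Newton increments, the residuals and the distance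
  to the Picard iterates at \<open>\<alpha>\<close> by the corresponding quantities at \<open>\<rho>\<close>. As the distance between
  the real Newton iterates and the Picard iterates at \<open>\<rho>\<close> tends to \<open>0\<close>, the complex Newton iterates have the
  same limit \<open>S(\<alpha>)\<close> as the Picard iterates at \<open>\<alpha>\<close>.

  Invertibility of \<open>Id - \<partial>H/\<partial>Y\<close> is a maximum principle: \<open>d \<le> (\<partial>H/\<partial>Y) d\<close> implies \<open>d \<le> 0\<close>, obtained by
  comparing \<open>d\<close> with the error of the Picard iteration at a slightly larger radius. A coordinate of \<open>S\<close>
  that is constant may lie on the boundary of the domain of convergence of \<open>H\<close>, where \<open>deriv\<close>
  is a junk value. Such coordinates depend acyclically on each other, and once they have
  reached their limit the corresponding Newton increment vanishes, so that the junk value is multiplied by \<open>0\<close>.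
\<close>

section \<open>Majorized power series in several variables\<close>

definition mon :: "('s::finite \<Rightarrow> 'a::comm_semiring_1) \<Rightarrow> ('s \<Rightarrow> nat) \<Rightarrow> 'a" where
  "mon x n = (\<Prod>s\<in>UNIV. x s ^ n s)"

text \<open>The formal partial derivative of \<open>mon\<close> in direction \<open>k\<close>.
  Truncation of the exponent at \<open>n k = 0\<close> is harmless because the factor
  \<open>of_nat (n k)\<close> is then \<open>0\<close>.\<close>

definition dmon :: "'s::finite \<Rightarrow> ('s \<Rightarrow> 'a::comm_semiring_1) \<Rightarrow> ('s \<Rightarrow> nat) \<Rightarrow> 'a" where
  "dmon k x n = of_nat (n k) * x k ^ (n k - 1) * (\<Prod>s\<in>UNIV - {k}. x s ^ n s)"

text \<open>Here \<open>y\<close> is the base value, \<open>z\<close> the new value and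
  \<open>l\<close> the linear part of the increment. Value, increment, linear part and remainder are
  bounded together because the four bounds jointly are preserved by products.\<close>

definition jet_dom :: "'a::real_normed_field \<Rightarrow> 'a \<Rightarrow> 'a \<Rightarrow> real \<Rightarrow> real \<Rightarrow> real \<Rightarrow> bool" where
  "jet_dom z y l Z Y L \<longleftrightarrow>
     norm y \<le> Y \<and> norm (z - y) \<le> Z - Y \<and> norm l \<le> L \<and> norm (z - y - l) \<le> Z - Y - L"

text \<open>By the Leibniz rule the four quantities of a product are polynomials with non-negative
  coefficients in those of the factors. The triangle inequality bounds them by the same polynomials
  in the majorants.\<close>

lemma jet_dom_mult:
  assumes "jet_dom z y l Z Y L" "jet_dom z' y' l' Z' Y' L'"
  shows "jet_dom (z * z') (y * y') (y * l' + l * y') (Z * Z') (Y * Y') (Y * L' + L * Y')"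
proof -
  have b: "norm (p * q) \<le> P * Q" if "norm p \<le> P" "norm q \<le> Q" for p q :: 'a and P Q
    using that by (simp add: norm_mult mult_mono')
  note a = assms[unfolded jet_dom_def]
  have "norm ((z - y) * (z' - y') + (z - y) * y' + y * (z' - y'))
      \<le> (Z - Y) * (Z' - Y') + (Z - Y) * Y' + Y * (Z' - Y')"
    using a by (intro norm_triangle_mono b) auto
  moreover have "norm (y * (z' - y' - l') + (z - y - l) * y' + (z - y) * (z' - y'))
      \<le> Y * (Z' - Y' - L') + (Z - Y - L) * Y' + (Z - Y) * (Z' - Y')"
    using a by (intro norm_triangle_mono b) auto
  moreover have "norm (y * l' + l * y') \<le> Y * L' + L * Y'"
    using a by (intro norm_triangle_mono b) auto
  moreover have "norm (y * y') \<le> Y * Y'"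
    using a by (intro b) auto
  ultimately show ?thesis
    unfolding jet_dom_def by (simp add: algebra_simps)
qed

lemma jet_dom_power:
  assumes "norm y \<le> Y" "norm (z - y) \<le> Z - Y"
  shows "jet_dom (z ^ n) (y ^ n) (of_nat n * y ^ (n - 1) * (z - y))
           (Z ^ n) (Y ^ n) (of_nat n * Y ^ (n - 1) * (Z - Y))"
proof (induction n)
  case 0
  show ?case by (simp add: jet_dom_def)
next
  case (Suc n)
  have "jet_dom z y (z - y) Z Y (Z - Y)"
    using assms by (simp add: jet_dom_def)
  from jet_dom_mult[OF this Suc.IH] show ?case
    \<comment> \<open>For \<open>n = 0\<close> the exponent \<open>n - 1\<close> is truncated, so
      this case is treated apart.\<close>
    by (cases n) (simp_all add: algebra_simps)
qed

lemma jet_dom_prod: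
  assumes "finite A" "\<And>s. s \<in> A \<Longrightarrow> jet_dom (z s) (y s) (l s) (Z s) (Y s) (L s)"
  shows "jet_dom (\<Prod>s\<in>A. z s) (\<Prod>s\<in>A. y s) (\<Sum>s\<in>A. l s * (\<Prod>s'\<in>A - {s}. y s'))
           (\<Prod>s\<in>A. Z s) (\<Prod>s\<in>A. Y s) (\<Sum>s\<in>A. L s * (\<Prod>s'\<in>A - {s}. Y s'))"
  using assms
proof (induction A rule: finite_induct)
  case empty
  show ?case by (simp add: jet_dom_def)
next
  case (insert a A)
  have leibniz: "(\<Sum>s\<in>insert a A. g s * (\<Prod>s'\<in>insert a A - {s}. f s'))
      = f a * (\<Sum>s\<in>A. g s * (\<Prod>s'\<in>A - {s}. f s')) + g a * (\<Prod>s\<in>A. f s)"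
    for f g :: "_ \<Rightarrow> 'c::comm_ring_1"
  proof -
    have "(\<Prod>s'\<in>insert a A - {s}. f s') = f a * (\<Prod>s'\<in>A - {s}. f s')" if "s \<in> A" for s
    proof -
      have "insert a A - {s} = insert a (A - {s})" using that insert by auto
      then show ?thesis using insert by simp
    qed
    then have "(\<Sum>s\<in>A. g s * (\<Prod>s'\<in>insert a A - {s}. f s'))
        = f a * (\<Sum>s\<in>A. g s * (\<Prod>s'\<in>A - {s}. f s'))"
      by (simp add: sum_distrib_left mult.left_commute)
    then show ?thesis using insert by (simp add: add.commute)
  qed
  show ?case
    unfolding leibniz using insert by (simp add: jet_dom_mult)
qed

lemma jet_dom_mon:
  fixes z y :: "'s::finite \<Rightarrow> 'a::real_normed_field"
  assumes "\<And>s. norm (y s) \<le> Y s" "\<And>s. norm (z s - y s) \<le> Z s - Y s"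
  shows "jet_dom (mon z n) (mon y n) (\<Sum>s\<in>UNIV. dmon s y n * (z s - y s))
           (mon Z n) (mon Y n) (\<Sum>s\<in>UNIV. dmon s Y n * (Z s - Y s))"
proof -
  have eq: "dmon s x n * d = of_nat (n s) * x s ^ (n s - 1) * d * (\<Prod>s'\<in>UNIV - {s}. x s' ^ n s')"
    for s d and x :: "'s \<Rightarrow> 'b::comm_ring_1"
    by (simp add: dmon_def mult_ac)
  show ?thesis
    unfolding mon_def eq by (intro jet_dom_prod jet_dom_power assms finite)
qed

lemma mon_nonneg: "(\<And>s. 0 \<le> X s) \<Longrightarrow> 0 \<le> mon X n" for X :: "_ \<Rightarrow> real"
  by (simp add: mon_def prod_nonneg)

lemma mon_mono: "(\<And>s. 0 \<le> X s) \<Longrightarrow> (\<And>s. X s \<le> Y s) \<Longrightarrow> mon X n \<le> mon Y n" for X :: "_ \<Rightarrow> real"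
  unfolding mon_def by (intro prod_mono) (auto intro: power_mono)

lemma dmon_nonneg: "(\<And>s. 0 \<le> X s) \<Longrightarrow> 0 \<le> dmon k X n" for X :: "_ \<Rightarrow> real"
  by (simp add: dmon_def prod_nonneg)

lemma norm_mon_le:
  fixes x :: "'s::finite \<Rightarrow> 'a::real_normed_field"
  assumes "\<And>s. norm (x s) \<le> X s"
  shows "norm (mon x n) \<le> mon X n"
  unfolding mon_def prod_norm[symmetric]
  by (intro prod_mono) (auto simp: norm_power intro: power_mono assms)

lemma norm_dmon_le:
  fixes x :: "'s::finite \<Rightarrow> 'a::real_normed_field"
  assumes "\<And>s. norm (x s) \<le> X s"
  shows "norm (dmon k x n) \<le> dmon k X n"
proof -
  have X: "0 \<le> X s" for s using assms[of s] norm_ge_zero order_trans by blast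
  have "norm (\<Prod>s\<in>UNIV - {k}. x s ^ n s) \<le> (\<Prod>s\<in>UNIV - {k}. X s ^ n s)"
    unfolding prod_norm[symmetric]
    by (intro prod_mono) (auto simp: norm_power intro: power_mono assms)
  moreover have "norm (x k ^ (n k - 1)) \<le> X k ^ (n k - 1)"
    by (auto simp: norm_power intro: power_mono assms)
  ultimately show ?thesis
    unfolding dmon_def norm_mult norm_of_nat
    by (intro mult_mono) (auto intro!: X prod_nonneg mult_nonneg_nonneg zero_le_power)
qed

lemma mon_convex:
  fixes Y Z :: "'s::finite \<Rightarrow> real"
  assumes "\<And>s. 0 \<le> Y s" "\<And>s. Y s \<le> Z s"
  shows "(\<Sum>s\<in>UNIV. dmon s Y n * (Z s - Y s)) \<le> mon Z n - mon Y n"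
proof -
  \<comment> \<open>Both majorized points are zero, so their increment and remainder vanish. The
    remainder bound then says that the remainder of the majorant is non-negative.\<close>
  have "jet_dom (mon (\<lambda>s. 0::real) n) (mon (\<lambda>s. 0) n) (\<Sum>s\<in>UNIV. dmon s (\<lambda>s. 0) n * (0 - 0))
           (mon Z n) (mon Y n) (\<Sum>s\<in>UNIV. dmon s Y n * (Z s - Y s))"
    using assms by (intro jet_dom_mon) auto
  then show ?thesis by (auto simp: jet_dom_def)
qed

text \<open>Raising \<open>X\<close> to \<open>Y\<close> increases the slope, and convexity bounds
  the slope at \<open>Y\<close>. A difference quotient thus dominates the derivative, which later
  gives its summability.\<close>

lemma dmon_le_mon_diff:
  fixes X Y Z :: "'s::finite \<Rightarrow> real"
  assumes "\<And>s. 0 \<le> X s" "\<And>s. X s \<le> Y s" "\<And>s. Y s \<le> Z s"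
  shows "dmon k X n * (Z k - Y k) \<le> mon Z n - mon Y n"
proof -
  have Y0: "0 \<le> Y s" for s using assms order_trans by blast
  have "dmon k X n * (Z k - Y k) \<le> dmon k Y n * (Z k - Y k)"
    using norm_dmon_le[of X Y k n] assms Y0
    by (intro mult_right_mono) (auto simp: dmon_nonneg)
  also have "\<dots> \<le> (\<Sum>s\<in>UNIV. dmon s Y n * (Z s - Y s))"
    using assms Y0 by (intro member_le_sum) (auto simp: dmon_nonneg)
  also have "\<dots> \<le> mon Z n - mon Y n"
    using assms Y0 by (intro mon_convex) auto
  finally show ?thesis .
qed

section \<open>Series with non-negative coefficients and their partial derivatives\<close>

text \<open>The coefficients are real but the argument lies in any Banach field, so that one series
  is evaluated both at the real majorant and at the complex point.\<close>

definition ps :: "(('s::finite \<Rightarrow> nat) \<Rightarrow> real) \<Rightarrow> ('s \<Rightarrow> 'a::{banach,real_normed_field}) \<Rightarrow> 'a" where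
  "ps a x = (\<Sum>\<^sub>\<infinity>n. of_real (a n) * mon x n)"

definition pd :: "(('s::finite \<Rightarrow> nat) \<Rightarrow> real) \<Rightarrow> 's \<Rightarrow> ('s \<Rightarrow> 'a::{banach,real_normed_field}) \<Rightarrow> 'a" where
  "pd a k x = (\<Sum>\<^sub>\<infinity>n. of_real (a n) * dmon k x n)"

lemma banach_summable_on_bound:
  fixes f :: "'i \<Rightarrow> 'a::banach"
  assumes "g summable_on A" "\<And>x. x \<in> A \<Longrightarrow> norm (f x) \<le> g x"
  shows "f summable_on A"
proof (rule abs_summable_summable, rule summable_on_comparison_test[OF assms(1)])
qed (use assms in auto)

lemma has_sum_diff:
  fixes f g :: "'i \<Rightarrow> 'a::real_normed_vector"
  assumes "(f has_sum x) A" "(g has_sum y) A"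
  shows "((\<lambda>i. f i - g i) has_sum (x - y)) A"
  using has_sum_add[OF assms(1), of "\<lambda>i. - g i" "- y"] assms(2) by (simp add: has_sum_uminus)

lemma summable_on_diff:
  fixes f g :: "'i \<Rightarrow> 'a::real_normed_vector"
  assumes "f summable_on A" "g summable_on A"
  shows "(\<lambda>i. f i - g i) summable_on A"
  using has_sum_diff[OF has_sum_infsum[OF assms(1)] has_sum_infsum[OF assms(2)]]
  by (rule has_sum_imp_summable)

lemma has_sum_sum:
  fixes f :: "'j \<Rightarrow> 'i \<Rightarrow> 'a::topological_comm_monoid_add"
  assumes "finite J" "\<And>j. j \<in> J \<Longrightarrow> (f j has_sum x j) A"
  shows "((\<lambda>i. \<Sum>j\<in>J. f j i) has_sum (\<Sum>j\<in>J. x j)) A"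
  using assms by (induction J rule: finite_induct) (auto intro!: has_sum_add)

text \<open>Splitting \<open>z ^ Suc p - y ^ Suc p\<close> as
  \<open>y * (z ^ p - y ^ p) + (z - y) * z ^ p\<close> gives the first-order bound by induction, and
  then the second-order one. The scale \<open>h\<close> keeps the bound a fixed multiple of
  \<open>(Y + h) ^ p\<close>, so it can be summed against coefficients of a series that converges at
  \<open>Y + h\<close>.\<close>

lemma power_remainder_le:
  fixes y z :: "'a::real_normed_field"
  assumes "norm y \<le> Y" "h > 0" "norm (z - y) \<le> h"
  shows "norm (z ^ p - y ^ p - of_nat p * y ^ (p - 1) * (z - y)) \<le> (norm (z - y) / h)\<^sup>2 * (Y + h) ^ p"
proof -
  define q where "q = norm (z - y) / h"
  have d: "norm (z - y) = q * h" and q: "0 \<le> q" using assms by (auto simp: q_def)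
  have Y: "0 \<le> Y" using assms(1) norm_ge_zero order_trans by blast
  have z: "norm z \<le> Y + h"
    using norm_triangle_ineq[of y "z - y"] assms by simp
  have diff: "norm (z ^ p - y ^ p) \<le> q * (Y + h) ^ p" for p
  proof (induction p)
    case (Suc p)
    have "norm (y * (z ^ p - y ^ p) + (z - y) * z ^ p) \<le> Y * (q * (Y + h) ^ p) + q * h * (Y + h) ^ p"
      unfolding d[symmetric]
      by (intro norm_triangle_mono order_trans[OF norm_mult_ineq] mult_mono)
        (use assms Suc Y q z in \<open>auto simp: norm_power power_mono\<close>)
    then show ?case by (simp add: algebra_simps)
  qed (use q in simp)
  have "norm (z ^ p - y ^ p - of_nat p * y ^ (p - 1) * (z - y)) \<le> q\<^sup>2 * (Y + h) ^ p"
  proof (induction p)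
    case (Suc p)
    have "norm (y * (z ^ p - y ^ p - of_nat p * y ^ (p - 1) * (z - y)) + (z - y) * (z ^ p - y ^ p))
        \<le> Y * (q\<^sup>2 * (Y + h) ^ p) + q * h * (q * (Y + h) ^ p)"
      unfolding d[symmetric]
      by (intro norm_triangle_mono order_trans[OF norm_mult_ineq] mult_mono)
        (use assms Suc Y q diff in auto)
    then show ?case by (cases p) (simp_all add: algebra_simps power2_eq_square)
  qed simp
  then show ?thesis by (simp add: q_def)
qed

context
  fixes a :: "('s::finite \<Rightarrow> nat) \<Rightarrow> real"
  assumes a: "\<And>n. 0 \<le> a n"
begin

definition conv_at :: "('s \<Rightarrow> real) \<Rightarrow> bool" where
  "conv_at Z \<longleftrightarrow> (\<forall>s. 0 \<le> Z s) \<and> (\<lambda>n. a n * mon Z n) summable_on UNIV"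

lemma has_sum_ps:
  fixes x :: "'s \<Rightarrow> 'a::{banach,real_normed_field}"
  assumes "conv_at Z" "\<And>s. norm (x s) \<le> Z s"
  shows "((\<lambda>n. of_real (a n) * mon x n) has_sum ps a x) UNIV"
  unfolding ps_def
  by (rule has_sum_infsum, rule banach_summable_on_bound[of "\<lambda>n. a n * mon Z n"])
    (use assms a in \<open>auto simp: conv_at_def norm_mult intro!: mult_left_mono norm_mon_le\<close>)

lemma conv_at_mono: "conv_at Z \<Longrightarrow> (\<And>s. 0 \<le> Y s) \<Longrightarrow> (\<And>s. Y s \<le> Z s) \<Longrightarrow> conv_at Y"
  using has_sum_ps[of Z Y] by (auto simp: conv_at_def summable_on_def)

text \<open>The increment bound of \<open>jet_dom_mon\<close>, multiplied by \<open>a n\<close> and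
  summed.\<close>

lemma norm_ps_diff_le:
  fixes z y :: "'s \<Rightarrow> 'a::{banach,real_normed_field}"
  assumes Z: "conv_at Z" and y: "\<And>s. norm (y s) \<le> Y s" and zy: "\<And>s. norm (z s - y s) \<le> Z s - Y s"
  shows "norm (ps a z - ps a y) \<le> ps a Z - ps a Y"
proof -
  have Y0: "0 \<le> Y s" for s using y[of s] norm_ge_zero order_trans by blast
  have YZ: "Y s \<le> Z s" for s using zy[of s] norm_ge_zero[of "z s - y s"] by linarith
  have zZ: "norm (z s) \<le> Z s" for s
    using norm_triangle_ineq[of "y s" "z s - y s"] y[of s] zy[of s] by simp
  have yZ: "norm (y s) \<le> Z s" for s using y[of s] YZ[of s] by linarith
  show ?thesis
  proof (rule norm_infsum_le)
    show "((\<lambda>n. of_real (a n) * mon z n - of_real (a n) * mon y n) has_sum ps a z - ps a y) UNIV"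
      by (intro has_sum_diff has_sum_ps[OF Z] zZ yZ)
    have "((\<lambda>n. of_real (a n) * mon Z n - of_real (a n) * mon Y n) has_sum ps a Z - ps a Y) UNIV"
      by (intro has_sum_diff has_sum_ps[OF Z]) (use Z Y0 YZ in \<open>auto simp: conv_at_def\<close>)
    then show "((\<lambda>n. a n * mon Z n - a n * mon Y n) has_sum ps a Z - ps a Y) UNIV"
      by simp
    show "norm (of_real (a n) * mon z n - of_real (a n) * mon y n) \<le> a n * mon Z n - a n * mon Y n" for n
      using jet_dom_mon[of y Y z Z n] y zy a[of n]
      by (auto simp: jet_dom_def norm_mult mult_left_mono simp flip: right_diff_distrib)
  qed
qed

lemma ps_mono:
  assumes "conv_at Z" "\<And>s. 0 \<le> Y s" "\<And>s. Y s \<le> Z s"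
  shows "ps a Y \<le> ps a Z"
  using norm_ps_diff_le[of Z Y Y Y] assms by simp

text \<open>The difference of the series at \<open>Z\<close> and at \<open>Y\<close>, divided by
  \<open>Z k - Y k\<close>, majorizes the derivative. The other coordinates may lie on the boundary
  of convergence.\<close>

lemma summable_pd:
  assumes Z: "conv_at Z" and X: "\<And>s. 0 \<le> X s" "\<And>s. X s \<le> Y s" "\<And>s. Y s \<le> Z s" and k: "Y k < Z k"
  shows "(\<lambda>n. a n * dmon k X n) summable_on UNIV"
proof (rule banach_summable_on_bound)
  have Y0: "0 \<le> Y s" for s using X order_trans by blast
  have "(\<lambda>n. a n * mon Z n) summable_on UNIV" "(\<lambda>n. a n * mon Y n) summable_on UNIV"
    using Z conv_at_mono[OF Z Y0 X(3)] by (auto simp: conv_at_def)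
  then have "(\<lambda>n. a n * mon Z n - a n * mon Y n) summable_on UNIV"
    by (rule summable_on_diff)
  then show "(\<lambda>n. (a n * mon Z n - a n * mon Y n) * (1 / (Z k - Y k))) summable_on UNIV"
    by (rule summable_on_cmult_left)
  show "norm (a n * dmon k X n) \<le> (a n * mon Z n - a n * mon Y n) * (1 / (Z k - Y k))" for n
  proof -
    have "a n * (dmon k X n * (Z k - Y k)) \<le> a n * (mon Z n - mon Y n)"
      using a X by (intro mult_left_mono dmon_le_mon_diff) auto
    then show ?thesis
      using k a[of n] X by (simp add: field_simps dmon_nonneg abs_mult)
  qed
qed

lemma has_sum_pd:
  fixes x :: "'s \<Rightarrow> 'a::{banach,real_normed_field}"
  assumes Z: "conv_at Z" and "\<And>s. norm (x s) \<le> Y s" "\<And>s. Y s \<le> Z s" "Y k < Z k"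
  shows "((\<lambda>n. of_real (a n) * dmon k x n) has_sum pd a k x) UNIV"
proof -
  have Y0: "0 \<le> Y s" for s using assms(2)[of s] norm_ge_zero order_trans by blast
  show ?thesis
    unfolding pd_def
    by (rule has_sum_infsum, rule banach_summable_on_bound, rule summable_pd[OF Z _ order_refl assms(3,4)])
      (use Y0 a assms in \<open>auto simp: norm_mult intro!: mult_left_mono norm_dmon_le\<close>)
qed

lemma norm_pd_le:
  fixes x :: "'s \<Rightarrow> 'a::{banach,real_normed_field}"
  assumes Z: "conv_at Z" and x: "\<And>s. norm (x s) \<le> Y s" and Y: "\<And>s. Y s \<le> Z s" "Y k < Z k"
  shows "norm (pd a k x) \<le> pd a k Y"
proof -
  have Y0: "0 \<le> Y s" for s using x[of s] norm_ge_zero order_trans by blast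
  show ?thesis
    by (rule norm_infsum_le[OF has_sum_pd[OF assms] has_sum_pd[OF Z _ Y]])
      (use Y0 a x in \<open>auto simp: norm_mult intro!: mult_left_mono norm_dmon_le\<close>)
qed

lemma pd_nonneg: "(\<And>s. 0 \<le> X s) \<Longrightarrow> 0 \<le> pd a k X" for X :: "'s \<Rightarrow> real"
  unfolding pd_def by (intro infsum_nonneg) (auto simp: a dmon_nonneg)

text \<open>A partial derivative may diverge in the directions where the increment vanishes; the factor
  \<open>0\<close> then cancels its junk value.\<close>

lemma has_sum_pd_increment:
  fixes x d :: "'s \<Rightarrow> 'a::{banach,real_normed_field}"
  assumes Z: "conv_at Z" and "\<And>s. norm (x s) \<le> Y s" "\<And>s. Y s \<le> Z s"
    and d: "\<And>s. Y s = Z s \<Longrightarrow> d s = 0"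
  shows "((\<lambda>n. of_real (a n) * (\<Sum>s\<in>UNIV. dmon s x n * d s)) has_sum (\<Sum>s\<in>UNIV. pd a s x * d s)) UNIV"
proof -
  have "((\<lambda>n. of_real (a n) * dmon s x n * d s) has_sum pd a s x * d s) UNIV" for s
  proof (cases "Y s = Z s")
    case True
    then show ?thesis using d by simp
  next
    case False
    then have "Y s < Z s" using assms(3)[of s] by simp
    then show ?thesis by (intro has_sum_cmult_left has_sum_pd[OF assms(1-3)])
  qed
  then have "((\<lambda>n. \<Sum>s\<in>UNIV. of_real (a n) * dmon s x n * d s) has_sum (\<Sum>s\<in>UNIV. pd a s x * d s)) UNIV"
    by (intro has_sum_sum) auto
  then show ?thesis by (simp add: sum_distrib_left mult.assoc)
qed

lemma ps_convex:
  assumes Z: "conv_at Z" and X: "\<And>s. 0 \<le> X s" "\<And>s. X s \<le> Y s" "\<And>s. Y s \<le> Z s"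
  shows "(\<Sum>s\<in>UNIV. pd a s X * (Z s - Y s)) \<le> ps a Z - ps a Y"
proof (rule has_sum_mono)
  have Y0: "0 \<le> Y s" for s using X order_trans by blast
  have "((\<lambda>n. of_real (a n) * mon Z n - of_real (a n) * mon Y n) has_sum ps a Z - ps a Y) UNIV"
    by (intro has_sum_diff has_sum_ps[OF Z]) (use Z Y0 X in \<open>auto simp: conv_at_def\<close>)
  then show "((\<lambda>n. a n * (mon Z n - mon Y n)) has_sum ps a Z - ps a Y) UNIV"
    by (simp add: right_diff_distrib)
  have "((\<lambda>n. of_real (a n) * (\<Sum>s\<in>UNIV. dmon s X n * (Z s - Y s))) has_sum
      (\<Sum>s\<in>UNIV. pd a s X * (Z s - Y s))) UNIV"
    by (rule has_sum_pd_increment[OF Z, of X Y]) (use X in auto)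
  then show "((\<lambda>n. a n * (\<Sum>s\<in>UNIV. dmon s X n * (Z s - Y s))) has_sum
      (\<Sum>s\<in>UNIV. pd a s X * (Z s - Y s))) UNIV" by simp
  show "a n * (\<Sum>s\<in>UNIV. dmon s X n * (Z s - Y s)) \<le> a n * (mon Z n - mon Y n)" for n
  proof (intro mult_left_mono a)
    have "(\<Sum>s\<in>UNIV. dmon s X n * (Z s - Y s)) \<le> (\<Sum>s\<in>UNIV. dmon s Y n * (Z s - Y s))"
      using X norm_dmon_le[of X Y _ n] by (intro sum_mono mult_right_mono) (auto simp: dmon_nonneg)
    also have "\<dots> \<le> mon Z n - mon Y n" by (intro mon_convex Y0 X)
    finally show "(\<Sum>s\<in>UNIV. dmon s X n * (Z s - Y s)) \<le> mon Z n - mon Y n" .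
  qed
qed

text \<open>The second-order analogue of \<open>norm_ps_diff_le\<close>. Wherever
  \<open>Y s = Z s\<close>, also \<open>z s = y s\<close>, so possibly divergent slopes are
  cancelled on both sides.\<close>

lemma norm_ps_remainder_le:
  fixes z y :: "'s \<Rightarrow> 'a::{banach,real_normed_field}"
  assumes Z: "conv_at Z" and y: "\<And>s. norm (y s) \<le> Y s" and zy: "\<And>s. norm (z s - y s) \<le> Z s - Y s"
  shows "norm (ps a z - ps a y - (\<Sum>s\<in>UNIV. pd a s y * (z s - y s)))
    \<le> ps a Z - ps a Y - (\<Sum>s\<in>UNIV. pd a s Y * (Z s - Y s))"
proof -
  have Y0: "0 \<le> Y s" for s using y[of s] norm_ge_zero order_trans by blast
  have YZ: "Y s \<le> Z s" for s using zy[of s] norm_ge_zero[of "z s - y s"] by linarith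
  have zZ: "norm (z s) \<le> Z s" for s
    using norm_triangle_ineq[of "y s" "z s - y s"] y[of s] zy[of s] by simp
  have yZ: "norm (y s) \<le> Z s" for s using y[of s] YZ[of s] by linarith
  show ?thesis
  proof (rule norm_infsum_le)
    show "((\<lambda>n. of_real (a n) * mon z n - of_real (a n) * mon y n
        - of_real (a n) * (\<Sum>s\<in>UNIV. dmon s y n * (z s - y s))) has_sum
        ps a z - ps a y - (\<Sum>s\<in>UNIV. pd a s y * (z s - y s))) UNIV"
      by (intro has_sum_diff has_sum_ps[OF Z] has_sum_pd_increment[OF Z y YZ] zZ yZ)
        (metis zy norm_le_zero_iff cancel_comm_monoid_add_class.diff_cancel)
    have "((\<lambda>n. of_real (a n) * mon Z n - of_real (a n) * mon Y n
        - of_real (a n) * (\<Sum>s\<in>UNIV. dmon s Y n * (Z s - Y s))) has_sum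
        ps a Z - ps a Y - (\<Sum>s\<in>UNIV. pd a s Y * (Z s - Y s))) UNIV"
      by (intro has_sum_diff has_sum_ps[OF Z] has_sum_pd_increment[OF Z _ YZ])
        (use Z Y0 YZ in \<open>auto simp: conv_at_def\<close>)
    then show "((\<lambda>n. a n * mon Z n - a n * mon Y n - a n * (\<Sum>s\<in>UNIV. dmon s Y n * (Z s - Y s))) has_sum
        ps a Z - ps a Y - (\<Sum>s\<in>UNIV. pd a s Y * (Z s - Y s))) UNIV"
      by simp
    show "norm (of_real (a n) * mon z n - of_real (a n) * mon y n
        - of_real (a n) * (\<Sum>s\<in>UNIV. dmon s y n * (z s - y s)))
      \<le> a n * mon Z n - a n * mon Y n - a n * (\<Sum>s\<in>UNIV. dmon s Y n * (Z s - Y s))" for n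
      using jet_dom_mon[of y Y z Z n] y zy a[of n]
      by (auto simp: jet_dom_def norm_mult mult_left_mono simp flip: right_diff_distrib)
  qed
qed

text \<open>A Fatou argument: finite partial sums are continuous and keep the bound \<open>C\<close>
  in the limit, and non-negative terms with bounded partial sums are summable. The limit may lie on
  the boundary of the domain of convergence.\<close>

lemma conv_at_limit:
  assumes u: "\<And>n. conv_at (u n)" "\<And>n. ps a (u n) \<le> C" and lim: "\<And>s. (\<lambda>n. u n s) \<longlonglongrightarrow> z s"
  shows "conv_at z" "ps a z \<le> C"
proof -
  have z0: "0 \<le> z s" for s
    using lim[of s] by (rule LIMSEQ_le_const) (use u in \<open>auto simp: conv_at_def\<close>)
  have fin: "(\<Sum>n\<in>A. a n * mon z n) \<le> C" if "finite A" for A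
  proof (rule LIMSEQ_le_const2)
    show "(\<lambda>i. \<Sum>n\<in>A. a n * mon (u i) n) \<longlonglongrightarrow> (\<Sum>n\<in>A. a n * mon z n)"
      unfolding mon_def by (intro tendsto_intros lim)
    have "(\<Sum>n\<in>A. a n * mon (u i) n) \<le> ps a (u i)" for i
      using u(1)[of i] finite_sum_le_infsum[of "\<lambda>n. a n * mon (u i) n" UNIV A] that
      by (simp add: ps_def conv_at_def a mon_nonneg)
    then show "\<exists>N. \<forall>i\<ge>N. (\<Sum>n\<in>A. a n * mon (u i) n) \<le> C"
      using u(2) order_trans by blast
  qed
  have "(\<lambda>n. a n * mon z n) summable_on UNIV"
    by (rule nonneg_bdd_above_summable_on) (auto simp: a z0 mon_nonneg intro!: bdd_aboveI2[where M=C] fin)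
  then show *: "conv_at z" by (simp add: conv_at_def z0)
  have "(\<Sum>\<^sub>\<infinity>n. a n * mon z n) \<le> C"
    using * by (intro infsum_le_finite_sums fin) (auto simp: conv_at_def)
  then show "ps a z \<le> C" by (simp add: ps_def)
qed

text \<open>Summing the quadratic remainders of the powers bounds the remainder of the series by a
  multiple of the square of \<open>norm (t - y k)\<close>.\<close>

lemma has_field_derivative_ps:
  fixes y :: "'s \<Rightarrow> 'a::{banach,real_normed_field}"
  assumes Z: "conv_at Z" and y: "\<And>s. norm (y s) \<le> Y s" and Y: "\<And>s. Y s \<le> Z s" "Y k < Z k"
  shows "((\<lambda>t. ps a (y(k := t))) has_field_derivative pd a k y) (at (y k))"
proof -
  \<comment> \<open>The room in direction \<open>k\<close>. As \<open>Y k + h = Z k\<close>, the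
    remainder bound of each term is a multiple of the term at \<open>Z\<close>.\<close>
  define h where "h = Z k - Y k"
  have h: "h > 0" using Y by (simp add: h_def)
  have mon_upd: "mon (y(k := t)) n = t ^ n k * (\<Prod>s\<in>UNIV - {k}. y s ^ n s)" for t n
    unfolding mon_def by (subst prod.remove[of _ k]) (auto intro!: arg_cong2[where f="(*)"] prod.cong)
  have bound: "norm (ps a (y(k := t)) - ps a (y(k := y k)) - pd a k y * (t - y k))
      \<le> (norm (t - y k) / h)\<^sup>2 * ps a Z" if t: "norm (t - y k) \<le> h" for t
  proof (rule norm_infsum_le)
    have t': "norm t \<le> Z k"
      using norm_triangle_ineq[of "y k" "t - y k"] t y[of k] by (simp add: h_def)
    have yZ: "norm (y s) \<le> Z s" for s using y Y order_trans by blast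
    show "((\<lambda>n. of_real (a n) * mon (y(k := t)) n - of_real (a n) * mon (y(k := y k)) n
        - of_real (a n) * dmon k y n * (t - y k)) has_sum
        ps a (y(k := t)) - ps a (y(k := y k)) - pd a k y * (t - y k)) UNIV"
      by (intro has_sum_diff has_sum_ps[OF Z] has_sum_cmult_left has_sum_pd[OF Z y Y])
        (use t' yZ in auto)
    show "((\<lambda>n. (norm (t - y k) / h)\<^sup>2 * (of_real (a n) * mon Z n)) has_sum
        (norm (t - y k) / h)\<^sup>2 * ps a Z) UNIV"
      by (intro has_sum_cmult_right has_sum_ps[OF Z]) (use Z in \<open>auto simp: conv_at_def\<close>)
    fix n
    define q where "q = (\<Prod>s\<in>UNIV - {k}. y s ^ n s)"
    define Q where "Q = (\<Prod>s\<in>UNIV - {k}. Z s ^ n s)"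
    have q: "norm q \<le> Q"
      unfolding q_def Q_def prod_norm[symmetric]
      by (intro prod_mono) (auto simp: norm_power intro: power_mono yZ)
    have "norm (t ^ n k - y k ^ n k - of_nat (n k) * y k ^ (n k - 1) * (t - y k))
        \<le> (norm (t - y k) / h)\<^sup>2 * (Y k + h) ^ n k"
      by (rule power_remainder_le[OF y h t])
    then have "norm (of_real (a n) * (q * (t ^ n k - y k ^ n k - of_nat (n k) * y k ^ (n k - 1) * (t - y k))))
        \<le> a n * (Q * ((norm (t - y k) / h)\<^sup>2 * (Y k + h) ^ n k))"
      unfolding norm_mult by (intro mult_mono q) (use a order_trans[OF norm_ge_zero q] in auto)
    moreover have "mon Z n = (Y k + h) ^ n k * Q"
      unfolding mon_def Q_def by (subst prod.remove[of _ k]) (auto simp: h_def)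
    moreover have "of_real (a n) * mon (y(k := t)) n - of_real (a n) * mon (y(k := y k)) n
        - of_real (a n) * dmon k y n * (t - y k)
      = of_real (a n) * (q * (t ^ n k - y k ^ n k - of_nat (n k) * y k ^ (n k - 1) * (t - y k)))"
      unfolding mon_upd by (simp add: dmon_def q_def algebra_simps)
    ultimately show "norm (of_real (a n) * mon (y(k := t)) n - of_real (a n) * mon (y(k := y k)) n
        - of_real (a n) * dmon k y n * (t - y k)) \<le> (norm (t - y k) / h)\<^sup>2 * (of_real (a n) * mon Z n)"
      by (simp add: mult_ac)
  qed
  have "((\<lambda>t. (ps a (y(k := t)) - ps a (y(k := y k))) / (t - y k) - pd a k y) \<longlongrightarrow> 0) (at (y k))"
  proof (rule Lim_null_comparison)
    show "((\<lambda>t. norm (t - y k) * (ps a Z / h\<^sup>2)) \<longlongrightarrow> 0) (at (y k))"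
      by (rule tendsto_eq_intros refl | simp)+
    have "norm ((ps a (y(k := t)) - ps a (y(k := y k))) / (t - y k) - pd a k y)
        \<le> norm (t - y k) * (ps a Z / h\<^sup>2)" if "t \<noteq> y k" "dist t (y k) < h" for t
    proof -
      have "(ps a (y(k := t)) - ps a (y(k := y k))) / (t - y k) - pd a k y
        = (ps a (y(k := t)) - ps a (y(k := y k)) - pd a k y * (t - y k)) / (t - y k)"
        using that by (simp add: field_simps)
      then show ?thesis
        using bound[of t] that h
        by (simp add: norm_divide dist_norm divide_le_eq power2_eq_square mult_ac)
    qed
    then show "\<forall>\<^sub>F t in at (y k). norm ((ps a (y(k := t)) - ps a (y(k := y k))) / (t - y k) - pd a k y)
        \<le> norm (t - y k) * (ps a Z / h\<^sup>2)"
      using h unfolding eventually_at by blast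
  qed
  then show ?thesis
    unfolding has_field_derivative_iff by (rule LIM_zero_cancel)
qed

end

section \<open>Counting structures and decompositions\<close>

lemma species_transport_mem:
  "is_species F \<Longrightarrow> fin_tuple U \<Longrightarrow> inj_tuple U \<sigma> \<Longrightarrow> x \<in> structs F U
    \<Longrightarrow> transport F U \<sigma> x \<in> structs F (img_tuple \<sigma> U)"
  unfolding is_species_def by blast

lemma species_transport_id:
  "is_species F \<Longrightarrow> fin_tuple U \<Longrightarrow> x \<in> structs F U \<Longrightarrow> (\<And>s u. u \<in> U s \<Longrightarrow> \<sigma> s u = u)
    \<Longrightarrow> transport F U \<sigma> x = x"
  unfolding is_species_def by blast

lemma species_transport_comp:
  "is_species F \<Longrightarrow> fin_tuple U \<Longrightarrow> inj_tuple U \<sigma> \<Longrightarrow> inj_tuple (img_tuple \<sigma> U) \<tau> \<Longrightarrow> x \<in> structs F U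
    \<Longrightarrow> transport F (img_tuple \<sigma> U) \<tau> (transport F U \<sigma> x) = transport F U (\<lambda>s. \<tau> s \<circ> \<sigma> s) x"
  unfolding is_species_def by blast

lemma finite_structs: "is_species F \<Longrightarrow> fin_tuple U \<Longrightarrow> finite (structs F U)"
  unfolding is_species_def by blast

text \<open>That transport ignores the values outside \<open>U\<close> is not an axiom. It follows by writing \<open>\<sigma>\<close> as \<open>\<sigma>'\<close>
  composed with a map that is the identity on \<open>U\<close>, which needs \<open>\<sigma>'\<close> to be globally bijective.\<close>

lemma species_transport_cong:
  assumes F: "is_species F" "fin_tuple U" "x \<in> structs F U"
    and bij: "\<And>s. bij (\<sigma>' s)" and eq: "\<And>s u. u \<in> U s \<Longrightarrow> \<sigma> s u = \<sigma>' s u"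
  shows "transport F U \<sigma> x = transport F U \<sigma>' x"
proof -
  define \<iota> where "\<iota> s u = inv (\<sigma>' s) (\<sigma> s u)" for s u
  have \<iota>: "\<iota> s u = u" if "u \<in> U s" for s u
    using that bij[of s] by (simp add: \<iota>_def eq bij_is_inj)
  have img: "img_tuple \<iota> U = U" using \<iota> by (auto simp: img_tuple_def fun_eq_iff)
  have "transport F (img_tuple \<iota> U) \<sigma>' (transport F U \<iota> x) = transport F U (\<lambda>s. \<sigma>' s \<circ> \<iota> s) x"
    using F bij \<iota> unfolding img
    by (intro species_transport_comp[where U=U and \<sigma>=\<iota>, unfolded img])
      (auto simp: inj_tuple_def inj_on_def bij_def)
  moreover have "(\<lambda>s. \<sigma>' s \<circ> \<iota> s) = \<sigma>"
    using bij by (auto simp: \<iota>_def fun_eq_iff bij_is_surj surj_f_inv_f)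
  ultimately show ?thesis
    using species_transport_id[OF F \<iota>] img by simp
qed

lemma transport_inverse:
  assumes F: "is_species F" "fin_tuple U" "x \<in> structs F U" and \<sigma>: "\<And>s. bij_betw (\<sigma> s) (U s) (V s)"
  shows "transport F V (\<lambda>s. inv_into (U s) (\<sigma> s)) (transport F U \<sigma> x) = x"
proof -
  have V: "V = img_tuple \<sigma> U" using \<sigma> by (auto simp: img_tuple_def bij_betw_def)
  have "transport F V (\<lambda>s. inv_into (U s) (\<sigma> s)) (transport F U \<sigma> x)
      = transport F U (\<lambda>s. inv_into (U s) (\<sigma> s) \<circ> \<sigma> s) x"
    unfolding V using F \<sigma>
    by (intro species_transport_comp) (auto simp: inj_tuple_def img_tuple_def bij_betw_def inj_on_inv_into)
  also have "\<dots> = x"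
    using F \<sigma> by (intro species_transport_id) (auto simp: bij_betw_def)
  finally show ?thesis .
qed

text \<open>Transport along a bijection of the labels is injective, since transport along the
  inverse undoes it.\<close>

lemma card_structs_le:
  assumes F: "is_species F" "fin_tuple U" "fin_tuple V" and c: "\<And>s. card (U s) = card (V s)"
  shows "card (structs F U) \<le> card (structs F V)"
proof -
  have "\<exists>h. bij_betw h (U s) (V s)" for s
    using F c[of s] by (intro finite_same_card_bij) (auto simp: fin_tuple_def)
  then obtain \<sigma> where \<sigma>: "\<And>s. bij_betw (\<sigma> s) (U s) (V s)" by metis
  have V: "img_tuple \<sigma> U = V" using \<sigma> by (auto simp: img_tuple_def bij_betw_def)
  have inj: "inj_tuple U \<sigma>" using \<sigma> by (auto simp: inj_tuple_def bij_betw_def)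
  show ?thesis
  proof (rule card_inj_on_le)
    show "inj_on (transport F U \<sigma>) (structs F U)"
      using transport_inverse[OF F(1,2) _ \<sigma>] by (intro inj_on_inverseI)
    show "transport F U \<sigma> ` structs F U \<subseteq> structs F V"
      using species_transport_mem[OF F(1,2) inj] V by auto
    show "finite (structs F V)" using F finite_structs by blast
  qed
qed

lemma card_structs_eq:
  assumes "is_species F" "fin_tuple U" "fin_tuple V" "\<And>s. card (U s) = card (V s)"
  shows "card (structs F U) = card (structs F V)"
  using assms by (intro antisym card_structs_le) auto

section \<open>Generating series with real coefficients\<close>

definition ecoef :: "('s::finite, 'x) species \<Rightarrow> ('s \<Rightarrow> nat) \<Rightarrow> real" where
  "ecoef F n = real (card (structs F (\<lambda>s. {1..n s}))) / (\<Prod>s\<in>UNIV. fact (n s))"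

lemma egs_coeff_ecoef: "egs_coeff F n = of_real (ecoef F n)"
  by (simp add: egs_coeff_def ecoef_def of_real_prod)

lemma ecoef_nonneg: "0 \<le> ecoef F n"
  by (simp add: ecoef_def prod_nonneg)

definition gfps :: "(unit, 'y) species \<Rightarrow> real fps" where
  "gfps G = Abs_fps (\<lambda>N. ecoef G (\<lambda>_. N))"

lemma gfps_nonneg: "0 \<le> fps_nth (gfps F) N"
  by (simp add: gfps_def ecoef_nonneg)

lemma card_structs_gfps:
  assumes "is_species G" "finite B"
  shows "real (card (structs G (\<lambda>_. B))) = fact (card B) * fps_nth (gfps G) (card B)"
proof -
  have "card (structs G (\<lambda>_. B)) = card (structs G (\<lambda>_. {1..card B}))"
    using assms by (intro card_structs_eq) (auto simp: fin_tuple_def)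
  then show ?thesis by (simp add: gfps_def ecoef_def)
qed

section \<open>Labelled products of species\<close>

text \<open>The structures on \<open>U\<close> of the product of the species \<open>G k\<close>.
  Blocks may be empty; \<open>extensional\<close> fixes the irrelevant values outside
  \<open>K\<close>, so that the families can be counted.\<close>

definition decomps ::
    "('k \<Rightarrow> (unit, 'y) species) \<Rightarrow> 'k set \<Rightarrow> nat set \<Rightarrow> ('k \<Rightarrow> (unit \<Rightarrow> nat set) \<times> 'y) set" where
  "decomps G K U = {b \<in> extensional K. (\<forall>k\<in>K. snd (b k) \<in> structs (G k) (fst (b k))) \<and>
     U = (\<Union>k\<in>K. fst (b k) ()) \<and>
     (\<forall>k\<in>K. \<forall>k'\<in>K. k \<noteq> k' \<longrightarrow> fst (b k) () \<inter> fst (b k') () = {})}"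

text \<open>Removing the block of \<open>k\<close> is inverse to adding it, which reduces a product
  over \<open>insert k K\<close> to a binary one.\<close>

lemma decomps_insert:
  assumes k: "k \<notin> K"
  shows "bij_betw (\<lambda>(B, x, b). b(k := (\<lambda>_. B, x)))
    (SIGMA B:Pow U. structs (G k) (\<lambda>_. B) \<times> decomps G K (U - B)) (decomps G (insert k K) U)"
proof (rule bij_betw_byWitness[where f' = "\<lambda>b. (fst (b k) (), snd (b k), b(k := undefined))"])
  have undef: "b k = undefined" if "b \<in> decomps G K V" for b V
    using that k by (auto simp: decomps_def extensional_def)
  show "\<forall>a\<in>SIGMA B:Pow U. structs (G k) (\<lambda>_. B) \<times> decomps G K (U - B).
      (\<lambda>b. (fst (b k) (), snd (b k), b(k := undefined))) ((\<lambda>(B, x, b). b(k := (\<lambda>_. B, x))) a) = a"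
    by (auto simp: fun_eq_iff dest!: undef)
  show "\<forall>b\<in>decomps G (insert k K) U.
      (\<lambda>(B, x, b). b(k := (\<lambda>_. B, x))) (fst (b k) (), snd (b k), b(k := undefined)) = b"
    by (auto simp: fun_eq_iff prod_eq_iff)
  show "(\<lambda>(B, x, b). b(k := (\<lambda>_. B, x))) `
      (SIGMA B:Pow U. structs (G k) (\<lambda>_. B) \<times> decomps G K (U - B)) \<subseteq> decomps G (insert k K) U"
  proof clarify
    fix B x b
    assume B: "B \<subseteq> U" and x: "x \<in> structs (G k) (\<lambda>_. B)" and b: "b \<in> decomps G K (U - B)"
    have neq: "(b(k := (\<lambda>_. B, x))) k' = b k'" if "k' \<in> K" for k' using that k by auto
    have un: "(\<Union>k'\<in>K. fst (b k') ()) = U - B" using b by (simp add: decomps_def)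
    show "b(k := (\<lambda>_. B, x)) \<in> decomps G (insert k K) U"
      unfolding decomps_def mem_Collect_eq
    proof (intro conjI)
      show "b(k := (\<lambda>_. B, x)) \<in> extensional (insert k K)"
        using b by (auto simp: decomps_def extensional_def)
      show "\<forall>k'\<in>insert k K. snd ((b(k := (\<lambda>_. B, x))) k') \<in> structs (G k') (fst ((b(k := (\<lambda>_. B, x))) k'))"
        using b x neq by (auto simp: decomps_def)
      show "U = (\<Union>k'\<in>insert k K. fst ((b(k := (\<lambda>_. B, x))) k') ())"
        using un B neq by auto
      show "\<forall>k1\<in>insert k K. \<forall>k2\<in>insert k K. k1 \<noteq> k2 \<longrightarrow>
          fst ((b(k := (\<lambda>_. B, x))) k1) () \<inter> fst ((b(k := (\<lambda>_. B, x))) k2) () = {}"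
        using b un k by (auto simp: decomps_def)
    qed
  qed
  show "(\<lambda>b. (fst (b k) (), snd (b k), b(k := undefined))) ` decomps G (insert k K) U
      \<subseteq> (SIGMA B:Pow U. structs (G k) (\<lambda>_. B) \<times> decomps G K (U - B))"
  proof (rule image_subsetI)
    fix b assume b: "b \<in> decomps G (insert k K) U"
    have eta: "(\<lambda>_. fst (b k) ()) = fst (b k)" by (simp add: fun_eq_iff)
    have neq: "(b(k := undefined)) k' = b k'" if "k' \<in> K" for k' using that k by auto
    have disj: "fst (b k) () \<inter> fst (b k') () = {}" if "k' \<in> K" for k'
      using b that k by (auto simp: decomps_def)
    have "b(k := undefined) \<in> decomps G K (U - fst (b k) ())"
      unfolding decomps_def mem_Collect_eq
    proof (intro conjI)
      show "b(k := undefined) \<in> extensional K"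
        using b by (auto simp: decomps_def extensional_def)
      show "\<forall>k'\<in>K. snd ((b(k := undefined)) k') \<in> structs (G k') (fst ((b(k := undefined)) k'))"
        using b neq by (auto simp: decomps_def)
      show "U - fst (b k) () = (\<Union>k'\<in>K. fst ((b(k := undefined)) k') ())"
        using b neq disj by (auto simp: decomps_def)
      show "\<forall>k1\<in>K. \<forall>k2\<in>K. k1 \<noteq> k2 \<longrightarrow>
          fst ((b(k := undefined)) k1) () \<inter> fst ((b(k := undefined)) k2) () = {}"
        using b k by (auto simp: decomps_def)
    qed
    then show "(fst (b k) (), snd (b k), b(k := undefined))
        \<in> (SIGMA B:Pow U. structs (G k) (\<lambda>_. B) \<times> decomps G K (U - B))"
      using b eta by (auto simp: decomps_def)
  qed
qed

lemma sum_Pow_card: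
  fixes f :: "nat \<Rightarrow> 'a::comm_semiring_1"
  assumes "finite U"
  shows "(\<Sum>B\<in>Pow U. f (card B)) = (\<Sum>j\<le>card U. of_nat (card U choose j) * f j)"
proof -
  have "(\<Sum>B\<in>Pow U. f (card B)) = (\<Sum>j\<le>card U. \<Sum>B\<in>{B\<in>Pow U. card B = j}. f (card B))"
    using assms by (intro sum.group[symmetric]) (auto intro: card_mono)
  also have "\<dots> = (\<Sum>j\<le>card U. of_nat (card U choose j) * f j)"
  proof (rule sum.cong)
    fix j
    have "(\<Sum>B\<in>{B\<in>Pow U. card B = j}. f (card B)) = (\<Sum>B\<in>{B. B \<subseteq> U \<and> card B = j}. f j)"
      by (rule sum.cong) auto
    then show "(\<Sum>B\<in>{B\<in>Pow U. card B = j}. f (card B)) = of_nat (card U choose j) * f j"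
      using n_subsets[OF assms, of j] by simp
  qed simp
  finally show ?thesis .
qed

text \<open>The product rule for exponential generating series. Choosing the block of the new index
  by its size gives a binomial coefficient, and the factorials turn the binomial convolution into a
  Cauchy product.\<close>

lemma card_decomps:
  assumes "finite K" "\<And>k. k \<in> K \<Longrightarrow> is_species (G k)" "finite U"
  shows "finite (decomps G K U) \<and>
    real (card (decomps G K U)) = fact (card U) * fps_nth (\<Prod>k\<in>K. gfps (G k)) (card U)"
  using assms
proof (induction K arbitrary: U rule: finite_induct)
  case empty
  have "decomps G {} U = (if U = {} then {\<lambda>_. undefined} else {})"
    by (auto simp: decomps_def)
  then show ?case using empty by simp
next
  case (insert k K)
  let ?N = "card U" and ?P = "fps_nth (\<Prod>k\<in>K. gfps (G k))" and ?g = "fps_nth (gfps (G k))"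
  define D where "D = (SIGMA B:Pow U. structs (G k) (\<lambda>_. B) \<times> decomps G K (U - B))"
  have bij: "bij_betw (\<lambda>(B, x, b). b(k := (\<lambda>_. B, x))) D (decomps G (insert k K) U)"
    unfolding D_def using insert by (intro decomps_insert)
  have IH: "finite (decomps G K (U - B))"
      "real (card (decomps G K (U - B))) = fact (card (U - B)) * ?P (card (U - B))" for B
    using insert.IH[of "U - B"] insert.prems by auto
  have fs: "finite (structs (G k) (\<lambda>_. B))" if "B \<subseteq> U" for B
    using insert.prems that by (intro finite_structs) (auto simp: fin_tuple_def finite_subset)
  have "finite D"
    unfolding D_def using insert.prems fs IH by (intro finite_SigmaI finite_cartesian_product) auto
  then have fin: "finite (decomps G (insert k K) U)" using bij bij_betw_finite by blast
  have "real (card (decomps G (insert k K) U)) = real (card D)"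
    using bij by (simp add: bij_betw_same_card)
  also have "\<dots> = (\<Sum>B\<in>Pow U. real (card (structs (G k) (\<lambda>_. B))) * real (card (decomps G K (U - B))))"
    unfolding D_def using insert.prems fs IH by (subst card_SigmaI) (auto simp: card_cartesian_product)
  also have "\<dots> = (\<Sum>B\<in>Pow U. (fact (card B) * ?g (card B)) * (fact (?N - card B) * ?P (?N - card B)))"
  proof (rule sum.cong)
    fix B assume "B \<in> Pow U"
    then have B: "finite B" "B \<subseteq> U" using insert.prems finite_subset by auto
    then show "real (card (structs (G k) (\<lambda>_. B))) * real (card (decomps G K (U - B)))
        = (fact (card B) * ?g (card B)) * (fact (?N - card B) * ?P (?N - card B))"
      using card_structs_gfps[of "G k" B] insert.prems IH(2)[of B] by (simp add: card_Diff_subset)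
  qed simp
  also have "\<dots> = (\<Sum>j\<le>?N. real (?N choose j) * ((fact j * ?g j) * (fact (?N - j) * ?P (?N - j))))"
    using insert.prems by (subst sum_Pow_card) auto
  also have "\<dots> = (\<Sum>j\<le>?N. fact ?N * (?g j * ?P (?N - j)))"
  proof (rule sum.cong)
    fix j assume "j \<in> {..?N}"
    then have "fact j * fact (?N - j) * (?N choose j) = fact ?N"
      by (intro binomial_fact_lemma) simp
    then have "fact j * fact (?N - j) * real (?N choose j) = fact ?N"
      by (metis of_nat_fact of_nat_mult)
    moreover have "real (?N choose j) * ((fact j * ?g j) * (fact (?N - j) * ?P (?N - j)))
        = (fact j * fact (?N - j) * real (?N choose j)) * (?g j * ?P (?N - j))"
      by (simp only: mult_ac)
    ultimately show "real (?N choose j) * ((fact j * ?g j) * (fact (?N - j) * ?P (?N - j)))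
        = fact ?N * (?g j * ?P (?N - j))"
      by simp
  qed simp
  also have "\<dots> = fact ?N * fps_nth (\<Prod>k\<in>insert k K. gfps (G k)) ?N"
    using insert by (simp add: fps_mult_nth sum_distrib_left atLeast0AtMost)
  finally show ?case using fin by simp
qed

section \<open>Counting assemblies\<close>

text \<open>Since \<open>same_assembly\<close> relates arbitrary triples, this is what keeps the
  class of an assembly among the assemblies on the same set.\<close>

lemma renaming_assemblies:
  assumes F: "is_species F" and r: "renaming F \<sigma> a a'" and a: "a \<in> assemblies F G U"
  shows "a' \<in> assemblies F G U"
proof -
  obtain I f b where a_def: "a = (I, f, b)" by (cases a)
  obtain I' f' b' where a'_def: "a' = (I', f', b')" by (cases a')
  have \<sigma>: "bij_betw (\<sigma> s) (I s) (I' s)" for s using r by (auto simp: renaming_def a_def a'_def)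
  have f': "f' = transport F I \<sigma> f" using r by (auto simp: renaming_def a_def a'_def)
  have b': "b' s (\<sigma> s i) = b s i" if "i \<in> I s" for s i
    using r that by (auto simp: renaming_def a_def a'_def)
  have I': "I' = img_tuple \<sigma> I" using \<sigma> by (auto simp: img_tuple_def bij_betw_def)
  have Is: "I' s = \<sigma> s ` I s" for s using \<sigma>[of s] by (auto simp: bij_betw_def)
  have inj: "\<sigma> s i = \<sigma> s j \<longleftrightarrow> i = j" if "i \<in> I s" "j \<in> I s" for s i j
    using \<sigma>[of s] that by (auto simp: bij_betw_def inj_on_def)
  have I: "fin_tuple I" "f \<in> structs F I" using a by (auto simp: assemblies_def a_def)
  have c1: "fin_tuple I'" using I by (auto simp: fin_tuple_def Is)
  have c2: "f' \<in> structs F I'"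
    unfolding f' I' using I F \<sigma> by (intro species_transport_mem) (auto simp: inj_tuple_def bij_betw_def)
  have c3: "U t = (\<Union>s. \<Union>i\<in>I' s. fst (b' s i) t)" for t
    using a b' by (auto simp: assemblies_def a_def Is)
  have c4: "fst (b' s i) t \<inter> fst (b' s' i') t = {}"
    if ii: "i \<in> I' s" "i' \<in> I' s'" "(s, i) \<noteq> (s', i')" for t s s' i i'
  proof -
    obtain j j' where j: "i = \<sigma> s j" "j \<in> I s" "i' = \<sigma> s' j'" "j' \<in> I s'"
      using ii by (auto simp: Is)
    then have "(s, j) \<noteq> (s', j')" using ii by auto
    then have "fst (b s j) t \<inter> fst (b s' j') t = {}"
      using a j unfolding assemblies_def a_def by blast
    then show ?thesis using b' j by simp
  qed
  have c5: "snd (b' s i) \<in> structs (G s) (fst (b' s i))" if "i \<in> I' s" for s i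
    using a that b' by (auto simp: assemblies_def a_def Is)
  show ?thesis
    unfolding assemblies_def a'_def mem_Collect_eq prod.case
    by (intro conjI allI ballI impI c1 c2 c3 c4 c5)
qed

lemma same_assembly_refl:
  assumes "is_species F" "a \<in> assemblies F G U"
  shows "(a, a) \<in> same_assembly F"
proof -
  have "renaming F (\<lambda>s i. i) a a"
    using assms by (auto simp: renaming_def assemblies_def intro!: species_transport_id)
      (auto simp: bij_betw_def)
  then show ?thesis by (auto simp: same_assembly_def)
qed

lemma same_assembly_sym:
  assumes F: "is_species F" and a: "a \<in> assemblies F G U" and aa': "(a, a') \<in> same_assembly F"
  shows "(a', a) \<in> same_assembly F"
proof -
  obtain I f b where a_def: "a = (I, f, b)" by (cases a)
  obtain I' f' b' where a'_def: "a' = (I', f', b')" by (cases a')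
  from aa' obtain \<sigma> where r: "renaming F \<sigma> a a'" by (auto simp: same_assembly_def)
  have \<sigma>: "bij_betw (\<sigma> s) (I s) (I' s)" for s using r by (auto simp: renaming_def a_def a'_def)
  have "transport F I' (\<lambda>s. inv_into (I s) (\<sigma> s)) f' = f"
    using transport_inverse[OF F _ _ \<sigma>, where x=f] r a by (auto simp: renaming_def a_def a'_def assemblies_def)
  moreover have "b s (inv_into (I s) (\<sigma> s) i) = b' s i" if "i \<in> I' s" for s i
  proof -
    have "i \<in> \<sigma> s ` I s" using \<sigma>[of s] that by (simp add: bij_betw_def)
    then have "inv_into (I s) (\<sigma> s) i \<in> I s" "\<sigma> s (inv_into (I s) (\<sigma> s) i) = i"
      by (auto intro: inv_into_into f_inv_into_f)
    moreover have "\<forall>i\<in>I s. b' s (\<sigma> s i) = b s i"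
      using r by (auto simp: renaming_def a_def a'_def)
    ultimately show ?thesis by metis
  qed
  ultimately have "renaming F (\<lambda>s. inv_into (I s) (\<sigma> s)) a' a"
    using \<sigma> by (auto simp: renaming_def a_def a'_def bij_betw_inv_into)
  then show ?thesis by (auto simp: same_assembly_def)
qed

lemma same_assembly_trans:
  assumes F: "is_species F" and a: "a \<in> assemblies F G U"
    and aa': "(a, a') \<in> same_assembly F" "(a', a'') \<in> same_assembly F"
  shows "(a, a'') \<in> same_assembly F"
proof -
  obtain I f b where a_def: "a = (I, f, b)" by (cases a)
  obtain I' f' b' where a'_def: "a' = (I', f', b')" by (cases a')
  obtain I'' f'' b'' where a''_def: "a'' = (I'', f'', b'')" by (cases a'')
  from aa' obtain \<sigma> \<tau> where r: "renaming F \<sigma> a a'" "renaming F \<tau> a' a''"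
    by (auto simp: same_assembly_def)
  have \<sigma>: "bij_betw (\<sigma> s) (I s) (I' s)" and \<tau>: "bij_betw (\<tau> s) (I' s) (I'' s)" for s
    using r by (auto simp: renaming_def a_def a'_def a''_def)
  have I': "img_tuple \<sigma> I = I'" using \<sigma> by (auto simp: img_tuple_def bij_betw_def)
  have "transport F (img_tuple \<sigma> I) \<tau> (transport F I \<sigma> f) = transport F I (\<lambda>s. \<tau> s \<circ> \<sigma> s) f"
    using F a \<sigma> \<tau> unfolding I'
    by (intro species_transport_comp[where \<sigma>=\<sigma> and U=I, unfolded I'])
      (auto simp: a_def assemblies_def inj_tuple_def bij_betw_def)
  then have "transport F I (\<lambda>s. \<tau> s \<circ> \<sigma> s) f = f''"
    using r I' by (auto simp: renaming_def a_def a'_def a''_def)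
  moreover have "\<forall>i\<in>I s. b'' s (\<tau> s (\<sigma> s i)) = b s i" for s
  proof
    fix i assume i: "i \<in> I s"
    then have "\<sigma> s i \<in> I' s" using \<sigma>[of s] by (auto simp: bij_betw_def)
    then show "b'' s (\<tau> s (\<sigma> s i)) = b s i"
      using r i by (auto simp: renaming_def a_def a'_def a''_def)
  qed
  ultimately have "renaming F (\<lambda>s. \<tau> s \<circ> \<sigma> s) a a''"
    using bij_betw_trans[OF \<sigma> \<tau>] by (auto simp: renaming_def a_def a''_def)
  then show ?thesis by (auto simp: same_assembly_def)
qed

lemma same_assembly_class_eq:
  assumes F: "is_species F" and a: "a \<in> assemblies F G U" "a' \<in> assemblies F G U"
  shows "same_assembly F `` {a} = same_assembly F `` {a'} \<longleftrightarrow> (a, a') \<in> same_assembly F"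
proof
  assume "same_assembly F `` {a} = same_assembly F `` {a'}"
  then show "(a, a') \<in> same_assembly F" using same_assembly_refl[OF F a(2)] by auto
next
  assume *: "(a, a') \<in> same_assembly F"
  then show "same_assembly F `` {a} = same_assembly F `` {a'}"
    using same_assembly_trans[OF F a(1)] same_assembly_trans[OF F a(2)] same_assembly_sym[OF F a(1) *]
    by blast
qed

section \<open>Assemblies with standard names of blocks\<close>

text \<open>With the names \<open>{1..n s}\<close>, renamings act on the names as permutations. The
  value \<open>undefined\<close> elsewhere makes the set finite.\<close>

definition canonical_assemblies ::
    "('s::finite, 'x) species \<Rightarrow> ('s \<Rightarrow> (unit, 'y) species) \<Rightarrow> nat set \<Rightarrow> ('s \<Rightarrow> nat)
       \<Rightarrow> ('s, 'x, unit, 'y) assembly set" where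
  "canonical_assemblies F G U n = {(I, f, b). (I, f, b) \<in> assemblies F G (\<lambda>_. U) \<and>
     I = (\<lambda>s. {1..n s}) \<and> (\<forall>s i. i \<notin> {1..n s} \<longrightarrow> b s i = undefined)}"

lemma exists_canonical_assembly:
  assumes F: "is_species F" and a: "a \<in> assemblies F G (\<lambda>_. U)"
  shows "\<exists>n. \<exists>a'\<in>canonical_assemblies F G U n. (a, a') \<in> same_assembly F"
proof -
  obtain I f b where a_def: "a = (I, f, b)" by (cases a)
  have fin: "finite (I s)" for s using a by (auto simp: a_def assemblies_def fin_tuple_def)
  define n where "n s = card (I s)" for s
  have "\<exists>h. bij_betw h (I s) {1..n s}" for s
    using fin[of s] by (intro finite_same_card_bij) (auto simp: n_def)
  then obtain \<sigma> where \<sigma>: "\<And>s. bij_betw (\<sigma> s) (I s) {1..n s}" by metis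
  define a' where "a' = ((\<lambda>s. {1..n s}), transport F I \<sigma> f,
    \<lambda>s i. if i \<in> {1..n s} then b s (inv_into (I s) (\<sigma> s) i) else undefined)"
  have mem: "\<sigma> s i \<in> {1..n s}" if "i \<in> I s" for s i using \<sigma>[of s] that by (auto simp: bij_betw_def)
  have inv: "inv_into (I s) (\<sigma> s) (\<sigma> s i) = i" if "i \<in> I s" for s i
    using \<sigma>[of s] that by (auto simp: bij_betw_def)
  have r: "renaming F \<sigma> a a'"
    unfolding renaming_def a_def a'_def using \<sigma> mem inv by auto
  from renaming_assemblies[OF F r a] have "a' \<in> canonical_assemblies F G U n"
    by (auto simp: canonical_assemblies_def a'_def)
  then show ?thesis using r by (auto simp: same_assembly_def)
qed

text \<open>The action of a tuple of permutations of the names. The inverse occurs because the block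
  called \<open>i\<close> receives the name \<open>\<sigma> s i\<close>.\<close>

definition rename_by ::
    "('s::finite, 'x) species \<Rightarrow> ('s, 'x, 't, 'y) assembly \<Rightarrow> ('s \<Rightarrow> nat \<Rightarrow> nat)
       \<Rightarrow> ('s, 'x, 't, 'y) assembly" where
  "rename_by F = (\<lambda>(I, f, b) \<sigma>. (I, transport F I \<sigma> f, \<lambda>s i. b s (inv (\<sigma> s) i)))"

text \<open>An orbit count: the canonical assemblies equivalent to \<open>a\<close> form an orbit of
  the product of the symmetric groups on the names, and rigidity makes the action on it
  free.\<close>

lemma card_renamings:
  fixes F :: "('s::finite, 'x) species" and G :: "'s \<Rightarrow> (unit, 'y) species"
  assumes F: "is_species F" and rigid: "rigid_assemblies F G" and U: "finite U"
    and a: "a \<in> canonical_assemblies F G U n"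
  shows "card {a' \<in> canonical_assemblies F G U n. (a, a') \<in> same_assembly F} = (\<Prod>s\<in>UNIV. fact (n s))"
proof -
  let ?I = "\<lambda>s. {1..n s}" and ?P = "PiE UNIV (\<lambda>s. {p. p permutes {1..n s}})"
  obtain f b where a_def: "a = (?I, f, b)" using a by (auto simp: canonical_assemblies_def)
  have ass: "a \<in> assemblies F G (\<lambda>_. U)" using a by (auto simp: canonical_assemblies_def)
  have f: "f \<in> structs F ?I" "fin_tuple ?I" using ass by (auto simp: a_def assemblies_def)
  have undef: "b s i = undefined" if "i \<notin> {1..n s}" for s i
    using a that by (auto simp: canonical_assemblies_def a_def)
  have perm: "\<sigma> s permutes {1..n s}" if "\<sigma> \<in> ?P" for \<sigma> s using that by auto
  have bij: "bij (\<sigma> s)" if "\<sigma> \<in> ?P" for \<sigma> s using perm[OF that] by (rule permutes_bij)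
  have inv_in: "inv (\<sigma> s) i \<in> {1..n s} \<longleftrightarrow> i \<in> {1..n s}" if "\<sigma> \<in> ?P" for \<sigma> s i
    using permutes_in_image[OF permutes_inv[OF perm[OF that]]] .
  have img: "img_tuple \<sigma> ?I = ?I" if "\<sigma> \<in> ?P" for \<sigma>
    using permutes_image[OF perm[OF that]] by (auto simp: img_tuple_def)
  have r: "renaming F \<sigma> a (rename_by F a \<sigma>)" if "\<sigma> \<in> ?P" for \<sigma>
    using bij[OF that] permutes_imp_bij[OF perm[OF that]]
    by (auto simp: renaming_def rename_by_def a_def bij_is_inj)
  have "{a' \<in> canonical_assemblies F G U n. (a, a') \<in> same_assembly F} = rename_by F a ` ?P"
  proof (intro equalityI subsetI)
    fix a' assume "a' \<in> rename_by F a ` ?P"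
    then obtain \<sigma> where \<sigma>: "\<sigma> \<in> ?P" "a' = rename_by F a \<sigma>" by blast
    have "a' \<in> assemblies F G (\<lambda>_. U)"
      using renaming_assemblies[OF F r[OF \<sigma>(1)] ass] \<sigma> by simp
    moreover have "b s (inv (\<sigma> s) i) = undefined" if "i \<notin> {1..n s}" for s i
      using inv_in[OF \<sigma>(1)] that by (intro undef) simp
    ultimately have "a' \<in> canonical_assemblies F G U n"
      unfolding \<sigma>(2) by (simp add: canonical_assemblies_def rename_by_def a_def)
    then show "a' \<in> {a' \<in> canonical_assemblies F G U n. (a, a') \<in> same_assembly F}"
      using r[OF \<sigma>(1)] \<sigma> by (auto simp: same_assembly_def)
  next
    fix a' assume "a' \<in> {a' \<in> canonical_assemblies F G U n. (a, a') \<in> same_assembly F}"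
    then obtain \<sigma> where a': "a' \<in> canonical_assemblies F G U n" and \<sigma>: "renaming F \<sigma> a a'"
      by (auto simp: same_assembly_def)
    obtain f' b' where a'_def: "a' = (?I, f', b')" using a' by (auto simp: canonical_assemblies_def)
    \<comment> \<open>Off the names \<open>\<sigma>\<close> is arbitrary; extension by the identity
      yields permutations of all labels with the same transport of \<open>f\<close>.\<close>
    define \<sigma>' where "\<sigma>' s i = (if i \<in> {1..n s} then \<sigma> s i else i)" for s i
    have "bij_betw (\<sigma> s) {1..n s} {1..n s}" for s
      using \<sigma> by (auto simp: renaming_def a_def a'_def)
    moreover have "bij_betw (\<sigma>' s) {1..n s} {1..n s} = bij_betw (\<sigma> s) {1..n s} {1..n s}" for s
      by (intro bij_betw_cong) (simp add: \<sigma>'_def)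
    ultimately have "\<sigma>' s permutes {1..n s}" for s
      by (intro bij_imp_permutes) (auto simp: \<sigma>'_def)
    then have P: "\<sigma>' \<in> ?P" by (intro PiE_I CollectI) simp_all
    have "transport F ?I \<sigma> f = transport F ?I \<sigma>' f"
      by (rule species_transport_cong[OF F f(2,1) bij[OF P]]) (simp add: \<sigma>'_def)
    then have "f' = transport F ?I \<sigma>' f"
      using \<sigma> by (simp add: renaming_def a_def a'_def)
    moreover have "b' s i = b s (inv (\<sigma>' s) i)" for s i
    proof (cases "i \<in> {1..n s}")
      case True
      then have m: "inv (\<sigma>' s) i \<in> {1..n s}" using inv_in[OF P] by simp
      have "\<sigma> s (inv (\<sigma>' s) i) = \<sigma>' s (inv (\<sigma>' s) i)" using m by (simp add: \<sigma>'_def)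
      also have "\<dots> = i" using bij[OF P, of s] by (simp add: bij_is_surj surj_f_inv_f)
      finally have "\<sigma> s (inv (\<sigma>' s) i) = i" .
      moreover have "\<forall>i\<in>{1..n s}. b' s (\<sigma> s i) = b s i"
        using \<sigma> by (auto simp: renaming_def a_def a'_def)
      ultimately show ?thesis using m by metis
    next
      case False
      then have "b s (inv (\<sigma>' s) i) = undefined" using inv_in[OF P] by (intro undef) simp
      moreover have "b' s i = undefined" using False a' by (auto simp: canonical_assemblies_def a'_def)
      ultimately show ?thesis by simp
    qed
    ultimately have "a' = rename_by F a \<sigma>'" by (auto simp: rename_by_def a_def a'_def)
    then show "a' \<in> rename_by F a ` ?P" using P by blast
  qed
  moreover have "inj_on (rename_by F a) ?P"
  proof (rule inj_onI)
    fix \<sigma> \<tau> assume \<sigma>: "\<sigma> \<in> ?P" and \<tau>: "\<tau> \<in> ?P" and eq: "rename_by F a \<sigma> = rename_by F a \<tau>"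
    \<comment> \<open>If \<open>\<sigma>\<close> and \<open>\<tau>\<close> rename \<open>a\<close>
      in the same way, then \<open>\<rho>\<close> is an automorphism of \<open>a\<close>, hence the
      identity on the names by rigidity.\<close>
    define \<rho> where "\<rho> = (\<lambda>s. inv (\<tau> s) \<circ> \<sigma> s)"
    have eq_f: "transport F ?I \<sigma> f = transport F ?I \<tau> f"
      and eq_b: "(\<lambda>s i. b s (inv (\<sigma> s) i)) = (\<lambda>s i. b s (inv (\<tau> s) i))"
      using eq unfolding rename_by_def a_def by (simp_all only: prod.case prod.inject)
    have it: "inj_tuple ?I (\<lambda>s. inv (\<tau> s))" "inj_tuple ?I \<sigma>" "inj_tuple ?I \<tau>"
      using bij[OF \<tau>] bij[OF \<sigma>] unfolding inj_tuple_def
      by (auto intro!: inj_on_subset[OF bij_is_inj] bij_imp_bij_inv)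
    have comp: "transport F ?I (\<lambda>s. inv (\<tau> s)) (transport F ?I \<kappa> f) = transport F ?I (\<lambda>s. inv (\<tau> s) \<circ> \<kappa> s) f"
      if "\<kappa> \<in> ?P" "inj_tuple ?I \<kappa>" for \<kappa>
      using species_transport_comp[OF F f(2) that(2) _ f(1), of "\<lambda>s. inv (\<tau> s)"] it img[OF that(1)] by simp
    have "transport F ?I \<rho> f = transport F ?I (\<lambda>s. inv (\<tau> s)) (transport F ?I \<sigma> f)"
      using comp[OF \<sigma>] it unfolding \<rho>_def by simp
    also have "\<dots> = transport F ?I (\<lambda>s. inv (\<tau> s)) (transport F ?I \<tau> f)"
      by (simp only: eq_f)
    also have "\<dots> = transport F ?I (\<lambda>s. inv (\<tau> s) \<circ> \<tau> s) f"
      using comp[OF \<tau>] it by simp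
    also have "\<dots> = f"
      using F f bij[OF \<tau>] by (intro species_transport_id) (auto simp: bij_is_inj)
    finally have "transport F ?I \<rho> f = f" .
    moreover have "b s (\<rho> s i) = b s i" for s i
    proof -
      have "b s (inv (\<sigma> s) (\<sigma> s i)) = b s (inv (\<tau> s) (\<sigma> s i))"
        using fun_cong[OF fun_cong[OF eq_b, of s], of "\<sigma> s i"] .
      then show ?thesis using bij[OF \<sigma>, of s] by (simp add: \<rho>_def bij_is_inj)
    qed
    moreover have "bij_betw (\<rho> s) {1..n s} {1..n s}" for s
      unfolding \<rho>_def
      by (intro permutes_imp_bij permutes_compose perm[OF \<sigma>] permutes_inv perm[OF \<tau>])
    ultimately have "renaming F \<rho> a a" by (auto simp: renaming_def a_def)
    then have fixed: "\<rho> s i = i" if "i \<in> {1..n s}" for s i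
      using rigid ass U that unfolding rigid_assemblies_def a_def by (auto simp: fin_tuple_def)
    have "\<sigma> s i = \<tau> s i" for s i
    proof (cases "i \<in> {1..n s}")
      case True
      then show ?thesis using fixed[OF True] bij[OF \<tau>, of s]
        by (metis \<rho>_def bij_is_surj comp_apply surj_f_inv_f[of "\<tau> s"])
    next
      case False
      then show ?thesis using perm[OF \<sigma>] perm[OF \<tau>] by (metis permutes_not_in)
    qed
    then show "\<sigma> = \<tau>" by blast
  qed
  ultimately have "card {a' \<in> canonical_assemblies F G U n. (a, a') \<in> same_assembly F} = card ?P"
    by (simp add: card_image)
  also have "\<dots> = (\<Prod>s\<in>UNIV. fact (n s))"
    by (simp add: card_PiE card_permutations)
  finally show ?thesis .
qed

text \<open>The \<open>F\<close>-structure on the names and the decomposition of \<open>U\<close>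
  into \<open>n s\<close> blocks of each sort \<open>s\<close> are chosen independently; the product
  rule counts the latter.\<close>

lemma card_canonical_assemblies:
  fixes F :: "('s::finite, 'x) species" and G :: "'s \<Rightarrow> (unit, 'y) species"
  assumes F: "is_species F" and G: "\<And>s. is_species (G s)" and U: "finite U"
  shows "finite (canonical_assemblies F G U n)"
    "real (card (canonical_assemblies F G U n)) = real (card (structs F (\<lambda>s. {1..n s})))
       * (fact (card U) * fps_nth (\<Prod>s\<in>UNIV. gfps (G s) ^ n s) (card U))"
proof -
  define K where "K = (SIGMA s:UNIV. {1..n s})"
  define D where "D = decomps (\<lambda>(s, i). G s) K U"
  have K: "finite K" by (simp add: K_def)
  have D: "finite D" "real (card D) = fact (card U) * fps_nth (\<Prod>(s, i)\<in>K. gfps (G s)) (card U)"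
    using card_decomps[OF K, of "\<lambda>(s, i). G s" U] G U by (auto simp: D_def case_prod_unfold)
  have D_iff: "case_prod b \<in> D \<longleftrightarrow> (\<forall>s i. i \<notin> {1..n s} \<longrightarrow> b s i = undefined) \<and>
      (\<forall>s. \<forall>i\<in>{1..n s}. snd (b s i) \<in> structs (G s) (fst (b s i))) \<and>
      U = (\<Union>s. \<Union>i\<in>{1..n s}. fst (b s i) ()) \<and>
      (\<forall>s s'. \<forall>i\<in>{1..n s}. \<forall>i'\<in>{1..n s'}. (s, i) \<noteq> (s', i') \<longrightarrow>
        fst (b s i) () \<inter> fst (b s' i') () = {})" for b
  proof -
    have "(\<Union>k\<in>K. fst (case_prod b k) ()) = (\<Union>s. \<Union>i\<in>{1..n s}. fst (b s i) ())"
      by (force simp: K_def)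
    moreover have "(\<forall>k\<in>K. P k) \<longleftrightarrow> (\<forall>s. \<forall>i\<in>{1..n s}. P (s, i))" for P
      by (simp add: K_def)
    moreover have "case_prod b \<in> extensional K \<longleftrightarrow> (\<forall>s i. i \<notin> {1..n s} \<longrightarrow> b s i = undefined)"
      by (simp add: K_def extensional_def)
    ultimately show ?thesis
      unfolding D_def decomps_def by simp blast
  qed
  have can_iff: "(\<lambda>s. {1..n s}, f, b) \<in> canonical_assemblies F G U n
      \<longleftrightarrow> f \<in> structs F (\<lambda>s. {1..n s}) \<and> case_prod b \<in> D" for f b
    unfolding D_iff canonical_assemblies_def assemblies_def by (simp add: fin_tuple_def) blast
  have bij: "bij_betw (\<lambda>(f, b). (\<lambda>s. {1..n s}, f, curry b)) (structs F (\<lambda>s. {1..n s}) \<times> D)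
      (canonical_assemblies F G U n)"
  proof (rule bij_betw_byWitness[where f' = "\<lambda>(I, f, b). (f, case_prod b)"])
    show "(\<lambda>(f, b). (\<lambda>s. {1..n s}, f, curry b)) ` (structs F (\<lambda>s. {1..n s}) \<times> D)
        \<subseteq> canonical_assemblies F G U n"
      using can_iff by auto
    show "(\<lambda>(I, f, b). (f, case_prod b)) ` canonical_assemblies F G U n
        \<subseteq> structs F (\<lambda>s. {1..n s}) \<times> D"
    proof (rule image_subsetI)
      fix a assume a: "a \<in> canonical_assemblies F G U n"
      then obtain f b where "a = (\<lambda>s. {1..n s}, f, b)" by (auto simp: canonical_assemblies_def)
      then show "(case a of (I, f, b) \<Rightarrow> (f, case_prod b)) \<in> structs F (\<lambda>s. {1..n s}) \<times> D"
        using a can_iff by simp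
    qed
  qed (auto simp: canonical_assemblies_def)
  have fin: "finite (structs F (\<lambda>s. {1..n s}))"
    by (rule finite_structs[OF F]) (simp add: fin_tuple_def)
  show "finite (canonical_assemblies F G U n)"
    using bij fin D bij_betw_finite by blast
  have "(\<Prod>(s, i)\<in>K. gfps (G s)) = (\<Prod>s\<in>UNIV. gfps (G s) ^ n s)"
    unfolding K_def by (subst prod.Sigma[symmetric]) auto
  then show "real (card (canonical_assemblies F G U n)) = real (card (structs F (\<lambda>s. {1..n s})))
       * (fact (card U) * fps_nth (\<Prod>s\<in>UNIV. gfps (G s) ^ n s) (card U))"
    using arg_cong[OF bij_betw_same_card[OF bij], of real] D by (simp add: card_cartesian_product)
qed

section \<open>The generating series of a composition\<close>

text \<open>Classes are sorted by their numbers \<open>n\<close> of blocks. Each class contains as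
  many canonical assemblies as the product of the \<open>fact (n s)\<close>, which becomes the
  denominator of \<open>ecoef F n\<close>.\<close>

theorem has_sum_ecoef_compose:
  fixes F :: "('s::finite, 'x) species" and G :: "'s \<Rightarrow> (unit, 'y) species"
  assumes F: "is_species F" and G: "\<And>s. is_species (G s)" and rigid: "rigid_assemblies F G"
    and fin: "finite (structs (compose F G) (\<lambda>_. {1..N}))"
  shows "((\<lambda>n. ecoef F n * fps_nth (\<Prod>s\<in>UNIV. gfps (G s) ^ n s) N) has_sum
    ecoef (compose F G) (\<lambda>_. N)) UNIV"
proof -
  define U where "U = {1..N}"
  have U: "finite U" "card U = N" by (auto simp: U_def)
  let ?cls = "\<lambda>a :: ('s, 'x, unit, 'y) assembly. same_assembly F `` {a}" and ?can = "canonical_assemblies F G U"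
  define Cl where "Cl n = ?cls ` ?can n" for n
  have ass: "a \<in> assemblies F G (\<lambda>_. U)" if "a \<in> ?can n" for a n
    using that by (auto simp: canonical_assemblies_def)
  have card_Cl: "real (card (Cl n)) = ecoef F n * fps_nth (\<Prod>s\<in>UNIV. gfps (G s) ^ n s) N * fact N" for n
  proof -
    have fin_can: "finite (?can n)" by (rule card_canonical_assemblies(1)[OF F G U(1)])
    have "card (?can n) = (\<Sum>c\<in>Cl n. card {a'. a' \<in> ?can n \<and> ?cls a' = c})"
      using sum.image_gen[OF fin_can, where g="?cls" and h="\<lambda>_. 1::nat"] by (simp add: Cl_def)
    also have "\<dots> = (\<Sum>c\<in>Cl n. \<Prod>s\<in>UNIV. fact (n s))"
    proof (rule sum.cong)
      fix c assume "c \<in> Cl n"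
      then obtain a where a: "a \<in> ?can n" "c = ?cls a" by (auto simp: Cl_def)
      have "{a'. a' \<in> ?can n \<and> ?cls a' = c} = {a' \<in> ?can n. (a, a') \<in> same_assembly F}"
        using same_assembly_class_eq[OF F ass[OF a(1)] ass] unfolding a(2) by (metis (no_types, lifting))
      then show "card {a'. a' \<in> ?can n \<and> ?cls a' = c} = (\<Prod>s\<in>UNIV. fact (n s))"
        using card_renamings[OF F rigid U(1) a(1)] by simp
    qed simp
    finally have can: "real (card (?can n)) = real (card (Cl n)) * (\<Prod>s\<in>UNIV. fact (n s))"
      by simp
    define P :: real where "P = (\<Prod>s\<in>UNIV. fact (n s))"
    define X where "X = fps_nth (\<Prod>s\<in>UNIV. gfps (G s) ^ n s) N"
    define q where "q = real (card (structs F (\<lambda>s. {1..n s})))"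
    have "P \<noteq> 0" by (simp add: P_def)
    moreover have "real (card (Cl n)) * P = q * (fact N * X)"
      using card_canonical_assemblies(2)[OF F G U(1), where n=n] can
      unfolding U(2) P_def X_def q_def by simp
    ultimately have "real (card (Cl n)) = q / P * X * fact N"
      by (simp add: field_simps)
    then show ?thesis unfolding ecoef_def P_def X_def q_def .
  qed
  have structs: "structs (compose F G) (\<lambda>_. U) = (\<Union>n. Cl n)"
  proof -
    have "structs (compose F G) (\<lambda>_. U) = ?cls ` assemblies F G (\<lambda>_. U)"
      by (auto simp: compose_def quotient_def)
    also have "\<dots> = (\<Union>n. Cl n)"
    proof (intro equalityI subsetI)
      fix c assume "c \<in> ?cls ` assemblies F G (\<lambda>_. U)"
      then obtain a where a: "a \<in> assemblies F G (\<lambda>_. U)" "c = ?cls a" by blast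
      obtain n a' where a': "a' \<in> ?can n" "(a, a') \<in> same_assembly F"
        using exists_canonical_assembly[OF F a(1)] by blast
      then have "c = ?cls a'"
        using same_assembly_class_eq[OF F a(1) ass[OF a'(1)]] a by simp
      then show "c \<in> (\<Union>n. Cl n)" using a' by (auto simp: Cl_def)
    next
      fix c assume "c \<in> (\<Union>n. Cl n)"
      then show "c \<in> ?cls ` assemblies F G (\<lambda>_. U)" using ass by (auto simp: Cl_def)
    qed
    finally show ?thesis .
  qed
  \<comment> \<open>A renaming preserves the number of blocks of each sort, so a class determines
    \<open>n\<close>.\<close>
  have disj: "n = n'" if c: "c \<in> Cl n" "c \<in> Cl n'" for c n n'
  proof -
    obtain a a' where a: "a \<in> ?can n" "a' \<in> ?can n'" "?cls a = ?cls a'"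
      using c unfolding Cl_def by (elim imageE) metis
    then have "(a, a') \<in> same_assembly F"
      using same_assembly_class_eq[OF F ass[OF a(1)] ass[OF a(2)]] by simp
    then obtain \<sigma> where "renaming F \<sigma> a a'" by (auto simp: same_assembly_def)
    moreover obtain f b f' b' where "a = (\<lambda>s. {1..n s}, f, b)" "a' = (\<lambda>s. {1..n' s}, f', b')"
      using a(1,2) unfolding canonical_assemblies_def by blast
    ultimately have "bij_betw (\<sigma> s) {1..n s} {1..n' s}" for s
      unfolding renaming_def by simp
    then have "card {1..n s} = card {1..n' s}" for s by (rule bij_betw_same_card)
    then show ?thesis by (simp add: fun_eq_iff)
  qed
  define T where "T = {n. Cl n \<noteq> {}}"
  have fin_Cl: "finite (\<Union>n. Cl n)" using fin structs by (simp add: U_def)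
  \<comment> \<open>Disjoint non-empty subsets \<open>Cl n\<close> of a finite set exist for
    finitely many \<open>n\<close> only.\<close>
  have "finite T"
  proof (rule finite_subset)
    show "finite ((\<lambda>c. THE n. c \<in> Cl n) ` (\<Union>n. Cl n))" using fin_Cl by (rule finite_imageI)
    show "T \<subseteq> (\<lambda>c. THE n. c \<in> Cl n) ` (\<Union>n. Cl n)"
    proof
      fix n assume "n \<in> T"
      then obtain c where c: "c \<in> Cl n" by (auto simp: T_def)
      then have "n = (THE n. c \<in> Cl n)" using disj[OF _ c] by (intro the_equality[symmetric])
      then show "n \<in> (\<lambda>c. THE n. c \<in> Cl n) ` (\<Union>n. Cl n)"
        by (rule image_eqI) (use c in blast)
    qed
  qed
  have "card (\<Union>n. Cl n) = card (\<Union>n\<in>T. Cl n)"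
    unfolding T_def by (rule arg_cong[where f=card]) blast
  also have "\<dots> = (\<Sum>n\<in>T. card (Cl n))"
    using \<open>finite T\<close>
  proof (rule card_UN_disjoint)
    show "\<forall>n\<in>T. finite (Cl n)" by (intro ballI finite_subset[OF _ fin_Cl]) blast
    show "\<forall>n\<in>T. \<forall>n'\<in>T. n \<noteq> n' \<longrightarrow> Cl n \<inter> Cl n' = {}" using disj by blast
  qed
  finally have "real (card (\<Union>n. Cl n)) = (\<Sum>n\<in>T. real (card (Cl n)))" by simp
  then have "ecoef (compose F G) (\<lambda>_. N) = (\<Sum>n\<in>T. real (card (Cl n))) / fact N"
    using structs unfolding ecoef_def U_def by simp
  also have "\<dots> = (\<Sum>n\<in>T. ecoef F n * fps_nth (\<Prod>s\<in>UNIV. gfps (G s) ^ n s) N)"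
    by (simp add: card_Cl sum_divide_distrib)
  finally have eq: "ecoef (compose F G) (\<lambda>_. N)
      = (\<Sum>n\<in>T. ecoef F n * fps_nth (\<Prod>s\<in>UNIV. gfps (G s) ^ n s) N)" .
  have zero: "ecoef F n * fps_nth (\<Prod>s\<in>UNIV. gfps (G s) ^ n s) N = 0" if "n \<notin> T" for n
  proof -
    have "Cl n = {}" using that by (simp add: T_def)
    then show ?thesis using card_Cl[of n] by simp
  qed
  show ?thesis
    using \<open>finite T\<close> subset_UNIV _ eq by (rule has_sum_finite_neutralI) (use zero in blast)
qed

section \<open>Generating series of the Picard iterates\<close>

lemma species_iso_card:
  assumes "iso_on P F G" "fin_tuple U" "P U"
  shows "card (structs F U) = card (structs G U)" "finite (structs F U) \<longleftrightarrow> finite (structs G U)"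
proof -
  obtain \<phi> where "bij_betw \<phi> (structs F U) (structs G U)"
    using assms unfolding iso_on_def by blast
  then show "card (structs F U) = card (structs G U)" "finite (structs F U) \<longleftrightarrow> finite (structs G U)"
    by (auto simp: bij_betw_same_card bij_betw_finite)
qed

lemma species_iso_ecoef: "species_iso F G \<Longrightarrow> ecoef F n = ecoef G n"
  using species_iso_card(1)[of "\<lambda>_. True" F G "\<lambda>s. {1..n s}"]
  by (simp add: species_iso_def ecoef_def fin_tuple_def)

lemma is_species_singleton: "is_species singleton_species"
proof -
  have "structs singleton_species U \<subseteq> U ()" for U by (auto simp: singleton_species_def)
  then have "finite (structs singleton_species U)" if "fin_tuple U" for U
    using that by (meson fin_tuple_def finite_subset)
  then show ?thesis
    unfolding is_species_def
    by (auto simp: singleton_species_def img_tuple_def)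
qed

lemma gfps_singleton: "gfps singleton_species = fps_X"
proof (rule fps_ext)
  fix N :: nat
  have "{u. {1..N} = {u}} = (if N = 1 then {1} else {})"
  proof -
    have "card {1..N} = 1" if "{1..N} = {u}" for u using that by simp
    then show ?thesis by auto
  qed
  then show "fps_nth (gfps singleton_species) N = fps_nth fps_X N"
    by (simp add: gfps_def ecoef_def singleton_species_def fps_X_nth)
qed

section \<open>Evaluation of one-variable series\<close>

definition evf :: "real fps \<Rightarrow> 'a::{banach,real_normed_field} \<Rightarrow> 'a" where
  "evf f z = (\<Sum>N. of_real (fps_nth f N) * z ^ N)"

definition nn_at :: "real fps \<Rightarrow> real \<Rightarrow> bool" where
  "nn_at f r \<longleftrightarrow> (\<forall>N. 0 \<le> fps_nth f N) \<and> summable (\<lambda>N. fps_nth f N * r ^ N)"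

lemma nn_at_norm_summable:
  fixes z :: "'a::{banach,real_normed_field}"
  assumes "nn_at f r" "norm z \<le> r"
  shows "summable (\<lambda>N. norm (of_real (fps_nth f N) * z ^ N))"
  by (rule summable_comparison_test'[of "\<lambda>N. fps_nth f N * r ^ N" 0])
    (use assms in \<open>auto simp: nn_at_def norm_mult norm_power intro!: mult_left_mono power_mono\<close>)

lemma evf_has_sum:
  fixes z :: "'a::{banach,real_normed_field}"
  assumes "nn_at f r" "norm z \<le> r"
  shows "((\<lambda>N. of_real (fps_nth f N) * z ^ N) has_sum evf f z) UNIV"
  unfolding evf_def
  by (rule norm_summable_imp_has_sum[OF nn_at_norm_summable[OF assms]
        summable_sums[OF summable_norm_cancel[OF nn_at_norm_summable[OF assms]]]])

lemma nn_at_1: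
  fixes z :: "'a::{banach,real_normed_field}"
  shows "nn_at 1 r" "evf 1 z = 1"
proof -
  have *: "(\<lambda>N. of_real (fps_nth 1 N) * x ^ N) = (\<lambda>N. if N = 0 then 1 else 0)" for x :: "'b::{banach,real_normed_field}"
    by auto
  show "evf 1 z = 1" unfolding evf_def * using sums_single[of 0 "\<lambda>_. 1::'a"] by (simp add: sums_iff)
  show "nn_at 1 r" using *[of r] by (simp add: nn_at_def)
qed

lemma nn_at_X:
  assumes "r \<ge> 0"
  shows "nn_at fps_X r" "evf fps_X z = z"
proof -
  have *: "(\<lambda>N. of_real (fps_nth fps_X N) * x ^ N) = (\<lambda>N. if N = 1 then x else 0)" for x :: "'b::{banach,real_normed_field}"
    by (auto simp: fps_X_nth)
  show "evf fps_X z = z" unfolding evf_def * using sums_single[of 1 "\<lambda>_. z"] by (simp add: sums_iff)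
  show "nn_at fps_X r" using *[of r] by (simp add: nn_at_def)
qed

lemma nn_at_mult:
  assumes f: "nn_at f r" and g: "nn_at g r" and r: "0 \<le> r"
  shows "nn_at (f * g) r" "norm z \<le> r \<Longrightarrow> evf (f * g) z = evf f z * evf g z"
proof -
  have *: "(\<lambda>N. of_real (fps_nth (f * g) N) * x ^ N) sums (evf f x * evf g x)"
    if "norm x \<le> r" for x :: "'b::{banach,real_normed_field}"
  proof -
    have "(\<lambda>N. \<Sum>i\<le>N. of_real (fps_nth f i) * x ^ i * (of_real (fps_nth g (N - i)) * x ^ (N - i)))
        sums (evf f x * evf g x)"
      unfolding evf_def by (intro Cauchy_product_sums nn_at_norm_summable[OF f that] nn_at_norm_summable[OF g that])
    moreover have "(\<Sum>i\<le>N. of_real (fps_nth f i) * x ^ i * (of_real (fps_nth g (N - i)) * x ^ (N - i)))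
        = of_real (fps_nth (f * g) N) * x ^ N" for N
    proof -
      have "of_real (fps_nth f i) * x ^ i * (of_real (fps_nth g (N - i)) * x ^ (N - i))
          = of_real (fps_nth f i * fps_nth g (N - i)) * x ^ N" if "i \<le> N" for i
      proof -
        have "x ^ N = x ^ i * x ^ (N - i)" using that by (simp flip: power_add)
        then show ?thesis by simp
      qed
      then have "(\<Sum>i\<le>N. of_real (fps_nth f i) * x ^ i * (of_real (fps_nth g (N - i)) * x ^ (N - i)))
          = (\<Sum>i\<le>N. of_real (fps_nth f i * fps_nth g (N - i)) * x ^ N)"
        by (intro sum.cong refl) blast
      then show ?thesis
        by (simp add: fps_mult_nth atLeast0AtMost sum_distrib_right)
    qed
    ultimately show ?thesis by simp
  qed
  show "norm z \<le> r \<Longrightarrow> evf (f * g) z = evf f z * evf g z"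
    using *[of z] by (simp add: evf_def sums_iff)
  have "0 \<le> fps_nth (f * g) N" for N
    using f g by (auto simp: fps_mult_nth nn_at_def intro!: sum_nonneg)
  then show "nn_at (f * g) r"
    using *[of r] r by (auto simp: nn_at_def sums_iff)
qed

lemma nn_at_power:
  assumes "nn_at f r" "0 \<le> r"
  shows "nn_at (f ^ n) r \<and> (norm z \<le> r \<longrightarrow> evf (f ^ n) z = evf f z ^ n)"
  using assms by (induction n) (auto simp: nn_at_1 nn_at_mult(1) nn_at_mult(2)[where r=r])

lemma nn_at_prod:
  assumes "finite A" "\<And>s. s \<in> A \<Longrightarrow> nn_at (f s) r" "0 \<le> r"
  shows "nn_at (\<Prod>s\<in>A. f s) r \<and> (norm z \<le> r \<longrightarrow> evf (\<Prod>s\<in>A. f s) z = (\<Prod>s\<in>A. evf (f s) z))"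
  using assms
  by (induction A rule: finite_induct) (auto simp: nn_at_1 nn_at_mult(1) nn_at_mult(2)[where r=r])

lemma nn_at_mon:
  fixes z :: "'a::{banach,real_normed_field}"
  assumes "\<And>s. nn_at (g s) r" "norm z \<le> r"
  shows "nn_at (\<Prod>s\<in>UNIV. g s ^ m s) r" "evf (\<Prod>s\<in>UNIV. g s ^ m s) z = mon (\<lambda>s. evf (g s) z) m"
proof -
  have r: "0 \<le> r" using assms(2) norm_ge_zero order_trans by blast
  have p: "nn_at (g s ^ m s) r" "evf (g s ^ m s) z = evf (g s) z ^ m s" for s
    using nn_at_power[OF assms(1) r, of s "m s" z] assms(2) by auto
  show "nn_at (\<Prod>s\<in>UNIV. g s ^ m s) r" "evf (\<Prod>s\<in>UNIV. g s ^ m s) z = mon (\<lambda>s. evf (g s) z) m"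
    using nn_at_prod[where f="\<lambda>s. g s ^ m s", OF finite p(1) r, where A=UNIV and z=z] assms(2) by (auto simp: mon_def p(2))
qed

lemma norm_evf_le:
  fixes z :: "'a::{banach,real_normed_field}"
  assumes "nn_at f r" "norm z \<le> r"
  shows "norm (evf f z) \<le> evf f (norm z)"
  by (rule norm_infsum_le[OF evf_has_sum[OF assms] evf_has_sum[where z="norm z", OF assms(1)]])
    (use assms in \<open>auto simp: nn_at_def norm_mult norm_power\<close>)

lemma evf_nonneg: "nn_at f r \<Longrightarrow> 0 \<le> x \<Longrightarrow> x \<le> r \<Longrightarrow> 0 \<le> evf f (x::real)"
  using has_sum_nonneg[OF evf_has_sum[of f r x]] by (auto simp: nn_at_def)

text \<open>Substitution commutes with evaluation: the double family indexed by the degree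
  \<open>N\<close> and the exponent \<open>m\<close> is absolutely summable, so the order of
  summation can be exchanged.\<close>

lemma formal_composition_eval:
  fixes a :: "('s::finite \<Rightarrow> nat) \<Rightarrow> real" and z :: "'a::{banach,real_normed_field}"
  assumes a: "\<And>m. 0 \<le> a m" and g: "\<And>s. nn_at (g s) r" and z: "norm z \<le> r" and c: "nn_at c r"
    and comp: "\<And>N. ((\<lambda>m. a m * fps_nth (\<Prod>s\<in>UNIV. g s ^ m s) N) has_sum fps_nth c N) UNIV"
  shows "((\<lambda>m. of_real (a m) * mon (\<lambda>s. evf (g s) z) m) has_sum evf c z) UNIV"
proof -
  have r: "0 \<le> r" using z norm_ge_zero order_trans by blast
  define P where "P m N = fps_nth (\<Prod>s\<in>UNIV. g s ^ m s) N" for m N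
  have nn: "nn_at (\<Prod>s\<in>UNIV. g s ^ m s) r" for m using nn_at_mon(1)[OF g z] .
  have P0: "0 \<le> P m N" for m N using nn[of m] by (simp add: nn_at_def P_def)
  \<comment> \<open>The terms are non-negative, summation over \<open>m\<close> gives the terms of
    \<open>c\<close> at \<open>r\<close>, and \<open>c\<close> converges there.\<close>
  have real_summable: "(\<lambda>(N, m). a m * P m N * r ^ N) summable_on UNIV \<times> UNIV"
  proof (rule summable_on_SigmaI)
    show "((\<lambda>m. case (N, m) of (N, m) \<Rightarrow> a m * P m N * r ^ N) has_sum (fps_nth c N * r ^ N)) UNIV" for N
      using has_sum_cmult_left[OF comp, of N "r ^ N"] by (simp add: P_def)
    show "(\<lambda>N. fps_nth c N * r ^ N) summable_on UNIV"
      using c r by (intro summable_nonneg_imp_summable_on) (auto simp: nn_at_def)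
  qed (use a P0 r in auto)
  have summable: "(\<lambda>(N, m). of_real (a m * P m N) * z ^ N) summable_on UNIV \<times> UNIV"
    by (rule banach_summable_on_bound[OF real_summable])
      (use a P0 z in \<open>auto simp: norm_mult norm_power intro!: mult_left_mono power_mono\<close>)
  define T where "T = infsum (\<lambda>(N, m). of_real (a m * P m N) * z ^ N) (UNIV \<times> UNIV)"
  have T: "((\<lambda>(N, m). of_real (a m * P m N) * z ^ N) has_sum T) (UNIV \<times> UNIV)"
    unfolding T_def using summable by (rule has_sum_infsum)
  have "((\<lambda>N. of_real (fps_nth c N) * z ^ N) has_sum T) UNIV"
  proof (rule has_sum_SigmaD[OF T])
    show "((\<lambda>m. case (N, m) of (N, m) \<Rightarrow> of_real (a m * P m N) * z ^ N) has_sum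
        of_real (fps_nth c N) * z ^ N) UNIV" for N
      using has_sum_cmult_left[OF has_sum_of_real[OF comp], of N "z ^ N"] by (simp add: P_def)
  qed
  then have eq: "T = evf c z" using evf_has_sum[OF c z] has_sum_unique by blast
  have T': "((\<lambda>(m, N). of_real (a m * P m N) * z ^ N) has_sum T) (UNIV \<times> UNIV)"
    using T by (subst (asm) has_sum_swap) simp
  have "((\<lambda>m. of_real (a m) * mon (\<lambda>s. evf (g s) z) m) has_sum T) UNIV"
  proof (rule has_sum_SigmaD[OF T'])
    show "((\<lambda>N. case (m, N) of (m, N) \<Rightarrow> of_real (a m * P m N) * z ^ N) has_sum
        of_real (a m) * mon (\<lambda>s. evf (g s) z) m) UNIV" for m
      using has_sum_cmult_right[OF evf_has_sum[OF nn z], of "of_real (a m)" m]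
      by (simp add: P_def nn_at_mon(2)[OF g z] mult.assoc)
  qed
  then show ?thesis using eq by simp
qed

text \<open>Order and non-negativity of the coefficients are carried through the induction together,
  since Cauchy products preserve the order only in the presence of non-negativity.\<close>

lemma fps_nth_prod_power_mono:
  fixes f g :: "'s::finite \<Rightarrow> real fps"
  assumes "\<And>s N. 0 \<le> fps_nth (f s) N" "\<And>s N. fps_nth (f s) N \<le> fps_nth (g s) N"
  shows "0 \<le> fps_nth (\<Prod>s\<in>UNIV. f s ^ m s) N"
    "fps_nth (\<Prod>s\<in>UNIV. f s ^ m s) N \<le> fps_nth (\<Prod>s\<in>UNIV. g s ^ m s) N"
proof -
  define le :: "real fps \<Rightarrow> real fps \<Rightarrow> bool" where
    "le u v \<longleftrightarrow> (\<forall>N. 0 \<le> fps_nth u N \<and> fps_nth u N \<le> fps_nth v N)" for u v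
  have mult: "le (u * u') (v * v')" if "le u v" "le u' v'" for u v u' v'
  proof -
    have "0 \<le> fps_nth u i" "0 \<le> fps_nth u' i" "0 \<le> fps_nth v i" "fps_nth u i \<le> fps_nth v i"
      "fps_nth u' i \<le> fps_nth v' i" for i
      using that order_trans unfolding le_def by blast+
    then show ?thesis
      unfolding le_def fps_mult_nth by (auto intro!: sum_nonneg sum_mono mult_mono)
  qed
  have one: "le 1 1" by (simp add: le_def)
  have power: "le (u ^ n) (v ^ n)" if "le u v" for u v n
    using that by (induction n) (auto intro: mult one)
  have fg: "le (f s) (g s)" for s using assms by (simp add: le_def)
  have "le (\<Prod>s\<in>A. f s ^ m s) (\<Prod>s\<in>A. g s ^ m s)" if "finite A" for A
    using that by (induction A rule: finite_induct) (auto intro!: one mult power fg)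
  from this[of UNIV] show "0 \<le> fps_nth (\<Prod>s\<in>UNIV. f s ^ m s) N"
    "fps_nth (\<Prod>s\<in>UNIV. f s ^ m s) N \<le> fps_nth (\<Prod>s\<in>UNIV. g s ^ m s) N"
    by (auto simp: le_def)
qed

section \<open>Coefficients and values of the Picard iterates\<close>

context
  fixes H :: "'m::finite \<Rightarrow> ('m option, 'x) species" and S :: "'m \<Rightarrow> (unit, 'y) species"
    and Y :: "nat \<Rightarrow> 'm \<Rightarrow> (unit, nat) species"
  assumes H: "\<And>i. is_species (H i)" and Y: "system_iteration H Y"
    and conv: "\<And>p. eventually (\<lambda>n. \<forall>i. species_iso_upto p (Y n i) (S i)) sequentially"
begin

lemma gfps_iterate_0: "gfps (Y 0 i) = 0"
proof (rule fps_ext)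
  fix N
  have "ecoef (Y 0 i) n = ecoef (zero_species :: (unit, nat) species) n" for n
    using Y by (intro species_iso_ecoef) (simp add: system_iteration_def)
  then show "fps_nth (gfps (Y 0 i)) N = fps_nth 0 N"
    by (simp add: gfps_def ecoef_def zero_species_def)
qed

lemma has_sum_gfps_iterate:
  "((\<lambda>m. ecoef (H i) m * fps_nth (\<Prod>s\<in>UNIV. case_option fps_X (\<lambda>j. gfps (Y n j)) s ^ m s) N) has_sum
     fps_nth (gfps (Y (Suc n) i)) N) UNIV"
proof -
  let ?G = "case_option singleton_species (Y n)"
  have iso: "species_iso (Y (Suc n) i) (compose (H i) ?G)"
    and comp: "composable (H i) ?G" and sp: "\<And>n j. is_species (Y n j)"
    using Y by (auto simp: system_iteration_def)
  \<comment> \<open>Finiteness passes through the isomorphism from the species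
    \<open>Y (Suc n) i\<close> to the composition.\<close>
  have "finite (structs (compose (H i) ?G) (\<lambda>_. {1..N}))"
    using species_iso_card(2)[OF iso[unfolded species_iso_def], of "\<lambda>_. {1..N}"]
      finite_structs[OF sp, of "\<lambda>_. {1..N}" "Suc n" i] by (simp add: fin_tuple_def)
  then have "((\<lambda>m. ecoef (H i) m * fps_nth (\<Prod>s\<in>UNIV. gfps (?G s) ^ m s) N) has_sum
      ecoef (compose (H i) ?G) (\<lambda>_. N)) UNIV"
    using comp by (intro has_sum_ecoef_compose H)
      (auto simp: composable_def sp is_species_singleton split: option.splits)
  moreover have "gfps (?G s) = case_option fps_X (\<lambda>j. gfps (Y n j)) s" for s
    by (simp add: gfps_singleton split: option.splits)
  ultimately show ?thesis
    by (simp add: gfps_def species_iso_ecoef[OF iso])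
qed

text \<open>Composition with \<open>H i\<close> is monotone in the coefficients of the inner series,
  and the iteration starts at \<open>0\<close>.\<close>

lemma gfps_iterate_mono: "fps_nth (gfps (Y n i)) N \<le> fps_nth (gfps (Y (Suc n) i)) N"
proof (induction n arbitrary: i N)
  case 0
  then show ?case by (simp add: gfps_iterate_0 gfps_nonneg)
next
  case (Suc n)
  have "fps_nth (\<Prod>s\<in>UNIV. case_option fps_X (\<lambda>j. gfps (Y n j)) s ^ m s) N
      \<le> fps_nth (\<Prod>s\<in>UNIV. case_option fps_X (\<lambda>j. gfps (Y (Suc n) j)) s ^ m s) N" for m
    by (rule fps_nth_prod_power_mono(2)) (auto simp: gfps_nonneg fps_X_nth Suc split: option.splits)
  then show ?case
    by (intro has_sum_mono[OF has_sum_gfps_iterate has_sum_gfps_iterate] mult_left_mono ecoef_nonneg)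
qed

lemma gfps_iterate_eventually:
  "eventually (\<lambda>n. fps_nth (gfps (Y n i)) N = fps_nth (gfps (S i)) N) sequentially"
  using conv[of N]
proof eventually_elim
  case (elim n)
  then have "card (structs (Y n i) (\<lambda>_. {1..N})) = card (structs (S i) (\<lambda>_. {1..N}))"
    unfolding species_iso_upto_def
    by (intro species_iso_card(1)[where P="\<lambda>U. (\<Sum>s\<in>UNIV. card (U s)) \<le> N"]) (auto simp: fin_tuple_def)
  then show ?case by (simp add: gfps_def ecoef_def)
qed

text \<open>For fixed \<open>N\<close> the coefficients increase with \<open>n\<close> and are
  eventually equal to that of \<open>S i\<close>.\<close>

lemma gfps_iterate_le: "fps_nth (gfps (Y n i)) N \<le> fps_nth (gfps (S i)) N"
proof -
  have mono: "fps_nth (gfps (Y n i)) N \<le> fps_nth (gfps (Y n' i)) N" if "n \<le> n'" for n'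
    using that by (rule lift_Suc_mono_le[of "\<lambda>n. fps_nth (gfps (Y n i)) N", rotated]) (rule gfps_iterate_mono)
  obtain M where "\<forall>n\<ge>M. fps_nth (gfps (Y n i)) N = fps_nth (gfps (S i)) N"
    using gfps_iterate_eventually unfolding eventually_sequentially by blast
  then show ?thesis using mono[of "max n M"] by simp
qed

context
  fixes r :: real
  assumes S_conv: "\<And>i. nn_at (gfps (S i)) r"
begin

lemma nn_at_iterate: "0 \<le> r \<Longrightarrow> nn_at (gfps (Y n i)) r"
  unfolding nn_at_def
proof (intro conjI allI gfps_nonneg)
  assume r: "0 \<le> r"
  show "summable (\<lambda>N. fps_nth (gfps (Y n i)) N * r ^ N)"
    by (rule summable_comparison_test'[of "\<lambda>N. fps_nth (gfps (S i)) N * r ^ N" 0])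
      (use S_conv[of i] gfps_iterate_le[of n i] r in
        \<open>auto simp: nn_at_def abs_mult abs_of_nonneg gfps_nonneg intro!: mult_right_mono\<close>)
qed

lemma iterate_eval:
  fixes z :: "'a::{banach,real_normed_field}"
  assumes z: "norm z \<le> r"
  shows "((\<lambda>m. of_real (ecoef (H i) m) * mon (case_option z (\<lambda>j. evf (gfps (Y n j)) z)) m) has_sum
    evf (gfps (Y (Suc n) i)) z) UNIV"
proof -
  have r: "0 \<le> r" using z norm_ge_zero order_trans by blast
  have eq: "evf (case_option fps_X (\<lambda>j. gfps (Y n j)) s) z = case_option z (\<lambda>j. evf (gfps (Y n j)) z) s" for s
    using nn_at_X(2)[OF r, of z] by (simp split: option.splits)
  have "nn_at (case_option fps_X (\<lambda>j. gfps (Y n j)) s) r" for s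
    using nn_at_X(1)[OF r] nn_at_iterate[OF r] by (simp split: option.splits)
  from formal_composition_eval[OF ecoef_nonneg this z nn_at_iterate[OF r] has_sum_gfps_iterate]
  show ?thesis by (simp add: eq)
qed

text \<open>Dominated convergence: every coefficient stabilizes, and the series of
  \<open>S i\<close> at \<open>r\<close> is a summable majorant.\<close>

lemma iterate_tendsto:
  fixes z :: "'a::{banach,real_normed_field}"
  assumes z: "norm z \<le> r"
  shows "(\<lambda>n. evf (gfps (Y n i)) z) \<longlonglongrightarrow> evf (gfps (S i)) z"
proof -
  have r: "0 \<le> r" using z norm_ge_zero order_trans by blast
  have "((\<lambda>n. \<Sum>N. of_real (fps_nth (gfps (Y n i)) N) * z ^ N) \<longlongrightarrow>
      (\<Sum>N. of_real (fps_nth (gfps (S i)) N) * z ^ N)) sequentially"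
  proof (rule tannerys_theorem[THEN conjunct2, THEN conjunct2])
    show "summable (\<lambda>N. fps_nth (gfps (S i)) N * r ^ N)" using S_conv by (simp add: nn_at_def)
    show "((\<lambda>n. of_real (fps_nth (gfps (Y n i)) N) * z ^ N) \<longlongrightarrow> of_real (fps_nth (gfps (S i)) N) * z ^ N)
        sequentially" for N
      by (rule tendsto_eventually, rule eventually_mono[OF gfps_iterate_eventually[of i N]]) simp
    show "\<forall>\<^sub>F (N, n) in sequentially \<times>\<^sub>F sequentially.
        norm (of_real (fps_nth (gfps (Y n i)) N) * z ^ N) \<le> fps_nth (gfps (S i)) N * r ^ N"
    proof (intro always_eventually allI, clarify)
      fix N n
      have "fps_nth (gfps (Y n i)) N * norm z ^ N \<le> fps_nth (gfps (S i)) N * r ^ N"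
        by (intro mult_mono power_mono gfps_iterate_le z gfps_nonneg) (use r in auto)
      then show "norm (of_real (fps_nth (gfps (Y n i)) N) * z ^ N) \<le> fps_nth (gfps (S i)) N * r ^ N"
        by (simp add: norm_mult norm_power abs_of_nonneg gfps_nonneg)
    qed
  qed simp
  then show ?thesis by (simp add: evf_def)
qed

end

end

section \<open>Majorization of the Newton iteration\<close>

abbreviation opt :: "'a \<Rightarrow> ('m \<Rightarrow> 'a) \<Rightarrow> 'm option \<Rightarrow> 'a" where
  "opt \<equiv> case_option"

lemma sum_UNIV_option: "(\<Sum>x\<in>UNIV. f x) = f None + (\<Sum>k\<in>UNIV. f (Some k))"
  for f :: "'m::finite option \<Rightarrow> 'a::comm_monoid_add"
  by (simp add: UNIV_option_conv sum.reindex)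

lemma opt_cases_le:
  fixes x x' :: real
  shows "x \<le> x' \<Longrightarrow> (\<And>k. y k \<le> y' k) \<Longrightarrow> opt x y s \<le> opt x' y' s"
  by (cases s) auto

lemma opt_nonneg:
  fixes x :: real
  shows "0 \<le> x \<Longrightarrow> (\<And>k. 0 \<le> y k) \<Longrightarrow> 0 \<le> opt x y s"
  by (cases s) auto

text \<open>The kernel of \<open>mat 1 - A\<close> consists of the fixed points of \<open>A\<close>,
  and a square matrix with trivial kernel is invertible.\<close>

lemma invertible_mat_minus:
  fixes A :: "'a::field ^ 'n ^ 'n"
  assumes "\<And>x. (\<And>i. x i = (\<Sum>k\<in>UNIV. A $ i $ k * x k)) \<Longrightarrow> (\<And>i. x i = 0)"
  shows "invertible (mat 1 - A)"
proof -
  have "x = 0" if "(mat 1 - A) *v x = 0" for x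
  proof -
    have fixpoint: "A *v x = x" using that by (simp add: matrix_vector_mult_diff_rdistrib)
    have "x $ i = (\<Sum>k\<in>UNIV. A $ i $ k * x $ k)" for i
    proof -
      have "(A *v x) $ i = (\<Sum>k\<in>UNIV. A $ i $ k * x $ k)" by (simp add: matrix_vector_mult_def)
      then show ?thesis unfolding fixpoint .
    qed
    from assms[of "\<lambda>i. x $ i", OF this] show ?thesis by (simp add: vec_eq_iff)
  qed
  then show ?thesis
    by (simp add: invertible_left_inverse matrix_left_invertible_ker)
qed

text \<open>The Newton increment written as a fixed point of \<open>A\<close> plus \<open>r\<close>,
  a form that can be bounded coordinatewise.\<close>

lemma matrix_inv_mat_minus_step:
  fixes A :: "'a::field ^ 'n ^ 'n"
  assumes "invertible (mat 1 - A)" and d: "d = matrix_inv (mat 1 - A) *v r"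
  shows "d $ i = (\<Sum>k\<in>UNIV. A $ i $ k * d $ k) + r $ i"
proof -
  have "(mat 1 - A) ** matrix_inv (mat 1 - A) = mat 1"
    using assms(1) unfolding invertible_def matrix_inv_def by (rule someI2_ex) blast
  then have "(mat 1 - A) *v d = r"
    unfolding d by (simp add: matrix_vector_mul_assoc)
  then have "d - A *v d = r" by (simp only: matrix_vector_mult_diff_rdistrib matrix_vector_mul_lid)
  then have "d = A *v d + r" by (simp only: diff_eq_eq add.commute)
  then have step: "d $ i = (A *v d) $ i + r $ i" by (metis vector_add_component)
  have "(A *v d) $ i = (\<Sum>k\<in>UNIV. A $ i $ k * d $ k)" by (simp add: matrix_vector_mult_def)
  with step show ?thesis by (rule back_subst[where P="\<lambda>q. d $ i = q + r $ i"])
qed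

text \<open>Positivity of all \<open>Z s\<close> keeps the other factors from annihilating the gain
  in direction \<open>k\<close>.\<close>

lemma mon_strict_mono:
  fixes Y Z :: "'s::finite \<Rightarrow> real"
  assumes "\<And>s. 0 \<le> Y s" "\<And>s. Y s \<le> Z s" "\<And>s. 0 < Z s" "Y k < Z k" "n k \<noteq> 0"
  shows "mon Y n < mon Z n"
proof -
  have split: "mon X n = X k ^ n k * (\<Prod>s\<in>UNIV - {k}. X s ^ n s)" for X :: "'s \<Rightarrow> real"
    unfolding mon_def by (subst prod.remove[of _ k]) auto
  have Q: "0 < (\<Prod>s\<in>UNIV - {k}. Z s ^ n s)" using assms by (intro prod_pos) auto
  have "mon Y n \<le> Y k ^ n k * (\<Prod>s\<in>UNIV - {k}. Z s ^ n s)"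
    unfolding split using assms by (intro mult_left_mono prod_mono) (auto intro: power_mono)
  also have "\<dots> < Z k ^ n k * (\<Prod>s\<in>UNIV - {k}. Z s ^ n s)"
    using assms Q by (intro mult_strict_right_mono power_strict_mono) auto
  also have "\<dots> = mon Z n" by (simp add: split)
  finally show ?thesis .
qed

text \<open>The iterates increase by monotonicity and so stay below \<open>l\<close>. The bound
  \<open>ps (a i) (opt r (w n)) \<le> l i\<close> survives the limit by
  \<open>conv_at_limit\<close>, giving convergence at \<open>l\<close> and half of the fixed point
  equation; monotonicity gives the other half.\<close>

lemma picard_iteration_limit:
  fixes a :: "'m::finite \<Rightarrow> ('m option \<Rightarrow> nat) \<Rightarrow> real" and w :: "nat \<Rightarrow> 'm \<Rightarrow> real"
  assumes a: "\<And>i n. 0 \<le> a i n" and r: "0 \<le> r"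
    and w0: "\<And>i. w 0 i = 0" and wS: "\<And>n i. w (Suc n) i = ps (a i) (opt r (w n))"
    and conv: "\<And>n i. conv_at (a i) (opt r (w n))" and lim: "\<And>i. (\<lambda>n. w n i) \<longlonglongrightarrow> l i"
  shows "0 \<le> w n i" "w n i \<le> w (Suc n) i" "w n i \<le> l i"
    "conv_at (a i) (opt r l)" "ps (a i) (opt r l) = l i"
proof -
  have nonneg: "0 \<le> w n i" for n i
  proof (induction n arbitrary: i)
    case (Suc n)
    have "0 \<le> a i m * mon (opt r (w n)) m" for m
      using a Suc r by (intro mult_nonneg_nonneg mon_nonneg opt_nonneg) auto
    then show ?case unfolding wS ps_def by (intro infsum_nonneg) simp
  qed (simp add: w0)
  have mono: "w n i \<le> w (Suc n) i" for n i
  proof (induction n arbitrary: i)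
    case (Suc n)
    have "ps (a i) (opt r (w n)) \<le> ps (a i) (opt r (w (Suc n)))"
      by (intro ps_mono a conv opt_nonneg opt_cases_le r nonneg Suc order_refl)
    then show ?case using wS[of n i] wS[of "Suc n" i] by simp
  qed (simp add: w0 nonneg)
  have le: "w n i \<le> l i" for n i
  proof -
    have "incseq (\<lambda>n. w n i)" by (rule incseq_SucI) (rule mono)
    from incseq_le[OF this lim] show ?thesis .
  qed
  have lim': "(\<lambda>n. opt r (w n) s) \<longlonglongrightarrow> opt r l s" for s
    using lim by (cases s) auto
  have psle: "ps (a i) (opt r (w n)) \<le> l i" for n i
    using le[of "Suc n" i] unfolding wS .
  show "0 \<le> w n i" "w n i \<le> w (Suc n) i" "w n i \<le> l i" by (fact nonneg mono le)+
  show conv': "conv_at (a i) (opt r l)"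
    by (rule conv_at_limit(1)[OF a conv psle lim'])
  show "ps (a i) (opt r l) = l i"
  proof (rule antisym)
    show "ps (a i) (opt r l) \<le> l i" by (rule conv_at_limit(2)[OF a conv psle lim'])
    have "w (Suc n) i \<le> ps (a i) (opt r l)" for n
      unfolding wS by (intro ps_mono a conv' opt_nonneg opt_cases_le r nonneg le order_refl)
    then show "l i \<le> ps (a i) (opt r l)"
      using LIMSEQ_le_const2[OF LIMSEQ_Suc[OF lim[of i]]] by blast
  qed
qed

section \<open>Picard iterations at two radii and the maximum principle\<close>

text \<open>\<open>u\<close> and \<open>v\<close> are the Picard iterations at
  \<open>\<rho>'\<close> and \<open>\<rho>\<close>, with limits \<open>s\<close> and
  \<open>\<sigma>\<close>. The larger radius gives room for differentiation; in a coordinate where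
  it gives none, \<open>stationary\<close> provides that \<open>u\<close> reaches its limit after
  finitely many steps.\<close>

locale majorized_newton =
  fixes a :: "'m::finite \<Rightarrow> ('m option \<Rightarrow> nat) \<Rightarrow> real" and \<rho> \<rho>' :: real
    and u v :: "nat \<Rightarrow> 'm \<Rightarrow> real" and s \<sigma> :: "'m \<Rightarrow> real"
  assumes a: "\<And>i n. 0 \<le> a i n" and \<rho>: "0 \<le> \<rho>" "\<rho> < \<rho>'"
    and u0: "\<And>i. u 0 i = 0" and uS: "\<And>n i. u (Suc n) i = ps (a i) (opt \<rho>' (u n))"
    and u_conv: "\<And>n i. conv_at (a i) (opt \<rho>' (u n))" and u_lim: "\<And>i. (\<lambda>n. u n i) \<longlonglongrightarrow> s i"
    and v0: "\<And>i. v 0 i = 0" and vS: "\<And>n i. v (Suc n) i = ps (a i) (opt \<rho> (v n))"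
    and v_conv: "\<And>n i. conv_at (a i) (opt \<rho> (v n))" and v_lim: "\<And>i. (\<lambda>n. v n i) \<longlonglongrightarrow> \<sigma> i"
    and s_pos: "\<And>i. 0 < s i" and \<sigma>_le: "\<And>i. \<sigma> i \<le> s i"
    and stationary: "\<And>i. \<sigma> i = s i \<Longrightarrow> \<exists>n. u n i = s i"
begin

lemma \<rho>': "0 \<le> \<rho>'" "0 < \<rho>'" "\<rho> \<le> \<rho>'" using \<rho> by auto

lemmas u = picard_iteration_limit[OF a \<rho>'(1) u0 uS u_conv u_lim]
lemmas v = picard_iteration_limit[OF a \<rho>(1) v0 vS v_conv v_lim]

lemma u_mono: "n \<le> n' \<Longrightarrow> u n i \<le> u n' i"
  using u(2) by (rule lift_Suc_mono_le[of "\<lambda>n. u n i"])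

definition finished :: "'m set" where "finished = {i. \<exists>n. u n i = s i}"

text \<open>The induction measure on \<open>finished\<close>; outside that set its value is
  arbitrary.\<close>

definition rank :: "'m \<Rightarrow> nat" where "rank i = (LEAST n. u n i = s i)"

definition dep :: "'m \<Rightarrow> 'm \<Rightarrow> bool" where "dep i k \<longleftrightarrow> (\<exists>n. a i n \<noteq> 0 \<and> n (Some k) \<noteq> 0)"

text \<open>If \<open>u\<close> reaches \<open>s i\<close> at step \<open>Suc q\<close>, then row
  \<open>i\<close> takes the same value at \<open>u q\<close> and at \<open>s\<close>. Strict
  monotonicity forces \<open>u q k = s k\<close> for every \<open>k\<close> on which the row
  depends.\<close>

lemma dep_finished:
  assumes "dep i k" "i \<in> finished"
  shows "k \<in> finished" "rank k < rank i"
proof -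
  obtain n where n: "a i n \<noteq> 0" "n (Some k) \<noteq> 0" using assms by (auto simp: dep_def)
  have p: "u (rank i) i = s i"
    using assms(2) unfolding finished_def rank_def by (auto intro: LeastI)
  \<comment> \<open>The iteration starts at \<open>0\<close>, which differs from \<open>s i\<close>
    by positivity.\<close>
  then have "rank i \<noteq> 0" using u0[of i] s_pos[of i] by (metis less_irrefl)
  then obtain q where q: "rank i = Suc q" by (cases "rank i") auto
  have "u q k = s k"
  proof (rule ccontr)
    assume "u q k \<noteq> s k"
    then have k: "u q k < s k" using u(3)[of q k] by simp
    let ?U = "opt \<rho>' (u q)" and ?Z = "opt \<rho>' s"
    have UZ: "0 \<le> ?U t" "?U t \<le> ?Z t" "0 < ?Z t" for t
      using u(1,3) s_pos \<rho>' by (auto split: option.splits)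
    have U: "((\<lambda>n. of_real (a i n) * mon ?U n) has_sum ps (a i) ?U) UNIV"
      by (rule has_sum_ps[OF a u_conv]) (use UZ in auto)
    have Z: "((\<lambda>n. of_real (a i n) * mon ?Z n) has_sum ps (a i) ?Z) UNIV"
      by (rule has_sum_ps[OF a u(4)]) (use UZ(3) in \<open>auto simp: less_imp_le\<close>)
    have le: "of_real (a i m) * mon ?U m \<le> of_real (a i m) * mon ?Z m" for m
      by (intro mult_left_mono mon_mono UZ) (simp add: a)
    have "mon ?U n < mon ?Z n"
      by (rule mon_strict_mono[where k="Some k"]) (use UZ n k in auto)
    then have lt: "of_real (a i n) * mon ?U n < of_real (a i n) * mon ?Z n"
      by (rule mult_strict_left_mono) (use n(1) a[of i n] in simp)
    have "ps (a i) ?U < ps (a i) ?Z"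
      by (rule has_sum_strict_mono[OF U Z, where x=n]) (rule le UNIV_I lt)+
    then show False using p unfolding q uS u(5) by (simp only: less_irrefl)
  qed
  then show "k \<in> finished" by (auto simp: finished_def)
  have "rank k \<le> q" unfolding rank_def by (rule Least_le) fact
  then show "rank k < rank i" using q by simp
qed

definition B :: "('m \<Rightarrow> real) \<Rightarrow> 'm \<Rightarrow> 'm \<Rightarrow> real" where
  "B t i k = pd (a i) (Some k) (opt \<rho> t)"

lemma B_nonneg: "(\<And>k. 0 \<le> t k) \<Longrightarrow> 0 \<le> B t i k"
  unfolding B_def using \<rho> by (intro pd_nonneg a opt_nonneg) auto

lemma pd_no_dep:
  fixes x :: "'m option \<Rightarrow> 'a::{banach,real_normed_field}"
  assumes "\<not> dep i k"
  shows "pd (a i) (Some k) x = 0"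
proof -
  have "of_real (a i n) * dmon (Some k) x n = 0" for n
    using assms by (auto simp: dep_def dmon_def)
  then show ?thesis unfolding pd_def by (intro infsum_0)
qed

text \<open>The slope is taken at radius \<open>\<rho>\<close>, the difference at any
  \<open>r \<ge> \<rho>\<close>: the maximum principle takes \<open>r = \<rho>'\<close>, the Newton
  step \<open>r = \<rho>\<close>. The \<open>Z\<close>-coordinate does not move and contributes
  nothing.\<close>

lemma B_convex:
  assumes t: "\<And>k. 0 \<le> t k" "\<And>k. t k \<le> y k" "\<And>k. y k \<le> z k" and r: "\<rho> \<le> r" and z: "conv_at (a i) (opt r z)"
  shows "(\<Sum>k\<in>UNIV. B t i k * (z k - y k)) \<le> ps (a i) (opt r z) - ps (a i) (opt r y)"
proof -
  have "(\<Sum>x\<in>UNIV. pd (a i) x (opt \<rho> t) * (opt r z x - opt r y x)) \<le> ps (a i) (opt r z) - ps (a i) (opt r y)"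
    using \<rho> by (intro ps_convex a z opt_nonneg opt_cases_le t r order_refl)
  then show ?thesis by (simp add: sum_UNIV_option B_def)
qed

text \<open>A maximum principle. On the finished coordinates it holds because their dependencies are
  acyclic; on the others \<open>d\<close> is dominated by a multiple of the error \<open>s - u l\<close> of the Picard iteration
  at the larger radius, which tends to \<open>0\<close> and contracts faster than \<open>B t\<close>.\<close>

lemma maximum_principle:
  assumes t: "\<And>k. 0 \<le> t k" "\<And>k. t k \<le> \<sigma> k" and d: "\<And>i. d i \<le> (\<Sum>k\<in>UNIV. B t i k * d k)"
  shows "d i \<le> 0"
proof -
  \<comment> \<open>As \<open>B t\<close> is non-negative, the positive part of \<open>d\<close>
    satisfies the same inequality; the aim is that it vanishes.\<close>
  define e where "e k = max 0 (d k)" for k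
  have e0: "0 \<le> e k" for k by (simp add: e_def)
  have B0: "0 \<le> B t i k" for i k using t by (intro B_nonneg)
  have e: "e i \<le> (\<Sum>k\<in>UNIV. B t i k * e k)" for i
  proof -
    have "d i \<le> (\<Sum>k\<in>UNIV. B t i k * e k)"
      by (rule order_trans[OF d]) (auto intro!: sum_mono mult_left_mono B0 simp: e_def)
    moreover have "0 \<le> (\<Sum>k\<in>UNIV. B t i k * e k)"
      by (intro sum_nonneg mult_nonneg_nonneg B0 e0)
    ultimately show ?thesis by (simp add: e_def)
  qed
  have fin: "e i = 0" if "i \<in> finished" for i
    using that
  proof (induction "rank i" arbitrary: i rule: less_induct)
    case less
    have "B t i k * e k = 0" for k
    proof (cases "dep i k")
      case True
      then show ?thesis using dep_finished[OF True less.prems] less.hyps by simp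
    next
      case False
      then show ?thesis by (simp add: B_def pd_no_dep)
    qed
    then have "(\<Sum>k\<in>UNIV. B t i k * e k) = 0" by (intro sum.neutral ballI)
    then show ?case using e[of i] e0[of i] by simp
  qed
  \<comment> \<open>The iterates tend to \<open>s k\<close>, which either exceeds
    \<open>\<sigma> k\<close> or equals it and is attained by \<open>stationary\<close>.\<close>
  have "\<exists>n. \<sigma> k \<le> u n k" for k
  proof (cases "\<sigma> k = s k")
    case True
    then obtain n where "u n k = s k" using stationary by blast
    then show ?thesis using True by (intro exI[of _ n]) simp
  next
    case False
    then have "\<sigma> k < s k" using \<sigma>_le[of k] by simp
    from order_tendstoD(1)[OF u_lim this] obtain N where "\<forall>n\<ge>N. \<sigma> k < u n k"
      unfolding eventually_sequentially by blast
    then have "\<sigma> k < u N k" by blast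
    then show ?thesis using less_imp_le by blast
  qed
  then obtain M where M: "\<And>k. \<sigma> k \<le> u (M k) k" by metis
  define m where "m = Max (range M)"
  have m: "\<sigma> k \<le> u (m + l) k" for k l
  proof -
    have "M k \<le> m + l" unfolding m_def by (intro trans_le_add1 Max_ge) auto
    from u_mono[OF this] show ?thesis using M[of k] by (rule order_trans[rotated])
  qed
  \<comment> \<open>Large enough for \<open>e k \<le> c * (s k - u m k)\<close>. Where
    \<open>u m k = s k\<close>, the summand is \<open>0\<close> by division by zero, and
    \<open>e k = 0\<close> because \<open>k\<close> is finished.\<close>
  define c where "c = (\<Sum>k\<in>UNIV. e k / (s k - u m k))"
  have q0: "0 \<le> e k / (s k - u m k)" for k using e0[of k] u(3)[of m k] by simp
  have c0: "0 \<le> c" unfolding c_def by (intro sum_nonneg q0)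
  \<comment> \<open>Convexity at \<open>\<rho>'\<close> together with the fixed point
    \<open>s\<close>: \<open>B t\<close> maps the error of one Picard step below the error of the
    next.\<close>
  have step: "(\<Sum>k\<in>UNIV. B t i k * (s k - u (m + l) k)) \<le> s i - u (Suc (m + l)) i" for i l
    using B_convex[of t "u (m + l)" s \<rho>' i] t m order_trans[OF t(2) m] u(3,4,5) \<rho>' by (simp add: uS)
  have bound: "e i \<le> c * (s i - u (m + l) i)" for i l
  proof (induction l arbitrary: i)
    case 0
    show ?case
    proof (cases "u m i = s i")
      case True
      then have "i \<in> finished" unfolding finished_def by blast
      then show ?thesis using fin True by simp
    next
      case False
      then have pos: "0 < s i - u m i" using u(3)[of m i] by simp
      have "e i / (s i - u m i) \<le> c" unfolding c_def by (rule member_le_sum) (auto simp: q0)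
      then show ?thesis using pos by (simp add: pos_divide_le_eq)
    qed
  next
    case (Suc l)
    have "e i \<le> (\<Sum>k\<in>UNIV. B t i k * e k)" by (rule e)
    also have "\<dots> \<le> (\<Sum>k\<in>UNIV. B t i k * (c * (s k - u (m + l) k)))"
      by (intro sum_mono mult_left_mono Suc B0)
    also have "\<dots> = c * (\<Sum>k\<in>UNIV. B t i k * (s k - u (m + l) k))"
      by (simp add: sum_distrib_left mult.left_commute)
    also have "\<dots> \<le> c * (s i - u (m + Suc l) i)"
      using step[of i l] c0 by (simp add: mult_left_mono)
    finally show ?case .
  qed
  have "(\<lambda>l. c * (s i - u (l + m) i)) \<longlonglongrightarrow> c * (s i - s i)"
    by (intro tendsto_intros LIMSEQ_ignore_initial_segment u_lim)
  then have "e i \<le> c * (s i - s i)"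
    by (rule LIMSEQ_le_const) (use bound[of i] in \<open>auto simp: add.commute\<close>)
  then show ?thesis by (simp add: e_def)
qed

section \<open>The real Newton iteration\<close>

definition F :: "('m \<Rightarrow> real) \<Rightarrow> 'm \<Rightarrow> real" where "F t i = ps (a i) (opt \<rho> t)"

definition newton_state :: "('m \<Rightarrow> real) \<Rightarrow> bool" where
  "newton_state t \<longleftrightarrow> (\<forall>i. 0 \<le> t i \<and> t i \<le> \<sigma> i \<and> t i \<le> F t i)"

text \<open>The Newton step as a linear equation for the increment, the form in which it is compared
  with the complex step.\<close>

definition newton_succ :: "('m \<Rightarrow> real) \<Rightarrow> ('m \<Rightarrow> real) \<Rightarrow> bool" where
  "newton_succ t t' \<longleftrightarrow> (\<forall>i. t i \<le> t' i \<and>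
     t' i - t i = (\<Sum>k\<in>UNIV. B t i k * (t' k - t k)) + (F t i - t i))"

lemma conv_le_\<sigma>: "(\<And>k. 0 \<le> t k) \<Longrightarrow> (\<And>k. t k \<le> \<sigma> k) \<Longrightarrow> conv_at (a i) (opt \<rho> t)"
  using \<rho> by (intro conv_at_mono[OF a v(4)] opt_nonneg opt_cases_le) auto

text \<open>The maximum principle gives solvability, the sign of the increment and the upper bound
  \<open>\<sigma>\<close>. Convexity then makes the new residual non-negative.\<close>

lemma newton_succ_exists:
  assumes "newton_state t"
  shows "\<exists>t'. newton_state t' \<and> newton_succ t t'"
proof -
  have t: "0 \<le> t i" "t i \<le> \<sigma> i" "t i \<le> F t i" for i using assms by (auto simp: newton_state_def)
  define A where "A = (\<chi> i k. B t i k)"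
  have A: "A $ i $ k = B t i k" for i k by (simp add: A_def)
  have "x i = 0" if x: "\<And>i. x i = (\<Sum>k\<in>UNIV. A $ i $ k * x k)" for x i
  proof -
    have "x i \<le> 0"
      by (rule maximum_principle[OF t(1,2)]) (rule eq_refl[OF x[unfolded A]])
    moreover have "- x i \<le> 0"
      by (rule maximum_principle[OF t(1,2)], rule eq_refl, subst x[unfolded A])
        (simp only: mult_minus_right sum_negf)
    ultimately show ?thesis by simp
  qed
  then have inv: "invertible (mat 1 - A)" by (rule invertible_mat_minus)
  define \<delta> where "\<delta> i = (matrix_inv (mat 1 - A) *v (\<chi> i. F t i - t i)) $ i" for i
  have \<delta>: "\<delta> i = (\<Sum>k\<in>UNIV. B t i k * \<delta> k) + (F t i - t i)" for i
    using matrix_inv_mat_minus_step[OF inv refl, where r="\<chi> i. F t i - t i" and i=i]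
    unfolding A vec_lambda_beta \<delta>_def .
  define t' where "t' i = t i + \<delta> i" for i
  have neg: "- \<delta> i \<le> 0" for i
  proof (rule maximum_principle[OF t(1,2)])
    show "- \<delta> i \<le> (\<Sum>k\<in>UNIV. B t i k * - \<delta> k)" for i
      using \<delta>[of i] t(3)[of i] by (simp add: sum_negf)
  qed
  have \<delta>0: "0 \<le> \<delta> i" for i using neg[of i] by simp
  \<comment> \<open>Since \<open>\<sigma>\<close> is a fixed point, convexity bounds
    \<open>t' - \<sigma>\<close> by its image under \<open>B t\<close>.\<close>
  have diff: "t' i - \<sigma> i \<le> 0" for i
  proof (rule maximum_principle[OF t(1,2)])
    fix i
    have "(\<Sum>k\<in>UNIV. B t i k * (\<sigma> k - t k)) \<le> ps (a i) (opt \<rho> \<sigma>) - ps (a i) (opt \<rho> t)"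
      by (rule B_convex) (use t v(4) in auto)
    then have "(\<Sum>k\<in>UNIV. B t i k * (\<sigma> k - t k)) \<le> \<sigma> i - F t i"
      by (simp add: F_def v(5))
    moreover have "(\<Sum>k\<in>UNIV. B t i k * (t' k - \<sigma> k))
        = (\<Sum>k\<in>UNIV. B t i k * \<delta> k) - (\<Sum>k\<in>UNIV. B t i k * (\<sigma> k - t k))"
      by (simp add: t'_def algebra_simps sum.distrib sum_subtractf)
    ultimately show "t' i - \<sigma> i \<le> (\<Sum>k\<in>UNIV. B t i k * (t' k - \<sigma> k))"
      using \<delta>[of i] by (simp add: t'_def)
  qed
  have t'\<sigma>: "t' i \<le> \<sigma> i" for i using diff[of i] by simp
  have t'0: "0 \<le> t' i" "t i \<le> t' i" for i using t(1)[of i] \<delta>0[of i] by (auto simp: t'_def)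
  have "t' i \<le> F t' i" for i
  proof -
    have "(\<Sum>k\<in>UNIV. B t i k * (t' k - t k)) \<le> F t' i - F t i"
      unfolding F_def by (rule B_convex) (use t t'0 in \<open>auto intro!: conv_le_\<sigma> t'\<sigma>\<close>)
    then show ?thesis using \<delta>[of i] by (simp add: t'_def)
  qed
  then have "newton_state t'" using t'0 t'\<sigma> by (simp add: newton_state_def)
  moreover have "newton_succ t t'" unfolding newton_succ_def
  proof (intro allI conjI t'0)
    show "t' i - t i = (\<Sum>k\<in>UNIV. B t i k * (t' k - t k)) + (F t i - t i)" for i
      unfolding t'_def add_diff_cancel_left' by (rule \<delta>)
  qed
  ultimately show ?thesis by blast
qed

lemma real_newton_exists:
  "\<exists>t. t 0 = (\<lambda>i. 0) \<and> (\<forall>n. newton_state (t n) \<and> newton_succ (t n) (t (Suc n)))"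
proof -
  have "0 \<le> F (\<lambda>i. 0) i" for i
  proof -
    have "v 0 = (\<lambda>i. 0)" by (simp add: fun_eq_iff v0)
    then show ?thesis using v(1)[of "Suc 0" i] vS[of 0 i] by (simp add: F_def)
  qed
  moreover have "0 \<le> \<sigma> i" for i using v(3)[of 0 i] v0 by simp
  ultimately have "newton_state (\<lambda>i. 0)" by (simp add: newton_state_def)
  then have "\<exists>t. \<forall>n. (newton_state (t n) \<and> (n = 0 \<longrightarrow> t n = (\<lambda>i. 0))) \<and> newton_succ (t n) (t (Suc n))"
    using newton_succ_exists by (intro dependent_nat_choice) blast+
  then obtain t where t: "\<forall>n. (newton_state (t n) \<and> (n = 0 \<longrightarrow> t n = (\<lambda>i. 0))) \<and> newton_succ (t n) (t (Suc n))"
    by blast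
  show ?thesis
  proof (intro exI conjI allI)
    show "t 0 = (\<lambda>i. 0)" "newton_state (t n)" "newton_succ (t n) (t (Suc n))" for n
      using t by blast+
  qed
qed

section \<open>A complex Newton step under its real majorant\<close>

context
  fixes \<alpha> :: complex and y :: "'m \<Rightarrow> complex" and t t' :: "'m \<Rightarrow> real" and J :: "'m \<Rightarrow> 'm \<Rightarrow> complex"
  assumes \<alpha>: "cmod \<alpha> = \<rho>" and t: "newton_state t" and t': "newton_state t'" and succ: "newton_succ t t'"
    and y: "\<And>i. cmod (y i) \<le> t i"
    and J: "\<And>i k. J i k = deriv (\<lambda>z. ps (a i) (opt \<alpha> (y(k := z)))) (y k)"
begin

lemma t_bounds: "0 \<le> t i" "t i \<le> \<sigma> i" "t i \<le> s i" "t i \<le> t' i" "t' i \<le> \<sigma> i"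
proof -
  show "0 \<le> t i" "t i \<le> \<sigma> i" "t' i \<le> \<sigma> i" using t t' unfolding newton_state_def by blast+
  then show "t i \<le> s i" using \<sigma>_le[of i] by linarith
  show "t i \<le> t' i" using succ unfolding newton_succ_def by blast
qed

lemma t_conv: "opt \<rho> t x \<le> opt \<rho>' s x" "cmod (opt \<alpha> y x) \<le> opt \<rho> t x"
  using t_bounds \<rho> \<alpha> y by (auto split: option.splits)

text \<open>The gap between \<open>t k\<close> and \<open>s k\<close> is the room that makes
  \<open>deriv\<close> the true partial derivative at \<open>y\<close>.\<close>

lemma J_eq_pd: "t k < s k \<Longrightarrow> J i k = pd (a i) (Some k) (opt \<alpha> y)"
proof -
  assume k: "t k < s k"
  have "((\<lambda>z. ps (a i) ((opt \<alpha> y)(Some k := z))) has_field_derivative pd (a i) (Some k) (opt \<alpha> y))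
      (at (opt \<alpha> y (Some k)))"
    by (rule has_field_derivative_ps[OF a u(4) t_conv(2,1)]) (use k in simp)
  moreover have "(opt \<alpha> y)(Some k := z) = opt \<alpha> (y(k := z))" for z
    by (auto simp: fun_eq_iff split: option.splits)
  ultimately show ?thesis unfolding J by (simp add: DERIV_imp_deriv)
qed

text \<open>No term changes with \<open>y k\<close>, so \<open>deriv\<close> is applied to a
  constant function and has the right value even where \<open>t k = s k\<close>.\<close>

lemma J_no_dep: "\<not> dep i k \<Longrightarrow> J i k = 0"
proof -
  assume dep: "\<not> dep i k"
  have "of_real (a i n) * mon (opt \<alpha> (y(k := z))) n = of_real (a i n) * mon (opt \<alpha> y) n" for z n
  proof (cases "a i n = 0")
    case False
    then have "n (Some k) = 0" using dep by (auto simp: dep_def)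
    then have "opt \<alpha> (y(k := z)) x ^ n x = opt \<alpha> y x ^ n x" for x
      by (cases x) auto
    then show ?thesis by (simp add: mon_def)
  qed simp
  then have "ps (a i) (opt \<alpha> (y(k := z))) = ps (a i) (opt \<alpha> y)" for z
    unfolding ps_def by (simp only:)
  then show ?thesis unfolding J by simp
qed

lemma norm_J_le: "t k < s k \<Longrightarrow> cmod (J i k) \<le> B t i k"
  unfolding J_eq_pd B_def by (rule norm_pd_le[OF a u(4) t_conv(2,1)]) simp

lemma not_finished_less: "k \<notin> finished \<Longrightarrow> t k < s k"
  using stationary[of k] t_bounds(2)[of k] \<sigma>_le[of k] by (force simp: finished_def)

text \<open>On finished coordinates, where \<open>J\<close> may hold junk, \<open>x\<close> vanishes
  by induction on \<open>rank\<close>. On the others \<open>B t\<close> dominates \<open>J\<close>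
  and the maximum principle applies to the moduli.\<close>

lemma J_injective:
  assumes x: "\<And>i. x i = (\<Sum>k\<in>UNIV. J i k * x k)"
  shows "x i = 0"
proof -
  have fin: "x i = 0" if "i \<in> finished" for i
    using that
  proof (induction "rank i" arbitrary: i rule: less_induct)
    case less
    have "J i k * x k = 0" for k
      using dep_finished[OF _ less.prems, of k] less.hyps[of k] J_no_dep[of i k] by auto
    then have "(\<Sum>k\<in>UNIV. J i k * x k) = 0" by (intro sum.neutral ballI)
    then show ?case using x[of i] by simp
  qed
  have "cmod (x i) \<le> 0"
  proof (rule maximum_principle[OF t_bounds(1,2)])
    fix i
    have "cmod (J i k * x k) \<le> B t i k * cmod (x k)" for k
      using fin[of k] norm_J_le[OF not_finished_less, of k i]
      by (cases "k \<in> finished") (auto simp: norm_mult mult_right_mono)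
    then have "cmod (\<Sum>k\<in>UNIV. J i k * x k) \<le> (\<Sum>k\<in>UNIV. B t i k * cmod (x k))"
      by (rule sum_norm_le)
    then show "cmod (x i) \<le> (\<Sum>k\<in>UNIV. B t i k * cmod (x k))" using x[of i] by simp
  qed
  then show ?thesis by simp
qed

context
  fixes \<delta> :: "'m \<Rightarrow> complex"
  assumes \<delta>: "\<And>i. \<delta> i = (\<Sum>k\<in>UNIV. J i k * \<delta> k) + (ps (a i) (opt \<alpha> y) - y i)"
    and residual: "\<And>i. cmod (ps (a i) (opt \<alpha> y) - y i) \<le> F t i - t i"
begin

lemma t'_eq: "t' i - t i = (\<Sum>k\<in>UNIV. B t i k * (t' k - t k)) + (F t i - t i)"
  using succ unfolding newton_succ_def by blast

lemma norm_\<delta>_le_aux: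
  assumes "\<And>k. cmod (J i k * \<delta> k) \<le> B t i k * e k"
  shows "cmod (\<delta> i) \<le> (\<Sum>k\<in>UNIV. B t i k * e k) + (F t i - t i)"
proof -
  have "cmod (\<delta> i) \<le> cmod (\<Sum>k\<in>UNIV. J i k * \<delta> k) + cmod (ps (a i) (opt \<alpha> y) - y i)"
    by (subst \<delta>) (rule norm_triangle_ineq)
  also have "\<dots> \<le> (\<Sum>k\<in>UNIV. B t i k * e k) + (F t i - t i)"
    by (intro add_mono residual sum_norm_le assms)
  finally show ?thesis .
qed

lemma B_t_nonneg: "0 \<le> B t i k"
  using t_bounds by (intro B_nonneg)

text \<open>Row \<open>i\<close> depends only on finished coordinates of smaller rank. If
  \<open>t k = s k\<close>, the real increment is zero, so the induction hypothesis gives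
  \<open>\<delta> k = 0\<close> and the factor \<open>J i k\<close> does no harm.\<close>

lemma norm_\<delta>_finished: "i \<in> finished \<Longrightarrow> cmod (\<delta> i) \<le> t' i - t i"
proof (induction "rank i" arbitrary: i rule: less_induct)
  case less
  have "cmod (J i k * \<delta> k) \<le> B t i k * (t' k - t k)" for k
  proof (cases "dep i k")
    case True
    have IH: "cmod (\<delta> k) \<le> t' k - t k"
      using dep_finished[OF True less.prems] less.hyps by simp
    show ?thesis
    proof (cases "t k < s k")
      case True
      then show ?thesis
        unfolding norm_mult by (intro mult_mono norm_J_le IH B_t_nonneg) auto
    next
      case False
      then have "t' k - t k = 0" using t_bounds(3-5)[of k] \<sigma>_le[of k] by simp
      then show ?thesis using IH by simp
    qed
  next
    case False
    then show ?thesis using J_no_dep[OF False] B_t_nonneg[of i k] t_bounds(4)[of k] by simp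
  qed
  from norm_\<delta>_le_aux[OF this] show ?case by (simp add: t'_eq[of i])
qed

lemma \<delta>_stationary: "\<not> t k < s k \<Longrightarrow> \<delta> k = 0"
proof -
  assume k: "\<not> t k < s k"
  then have "t' k - t k = 0" using t_bounds(3-5)[of k] \<sigma>_le[of k] by simp
  moreover have "k \<in> finished" using not_finished_less k by blast
  ultimately show ?thesis using norm_\<delta>_finished[of k] by simp
qed

text \<open>All junk entries now meet a zero increment, so the excess of
  \<open>cmod (\<delta> i)\<close> over the real increment satisfies the inequality of the maximum
  principle.\<close>

lemma norm_\<delta>_le: "cmod (\<delta> i) \<le> t' i - t i"
proof -
  have "cmod (\<delta> i) - (t' i - t i) \<le> 0"
  proof (rule maximum_principle[OF t_bounds(1,2)])
    fix i
    have "cmod (J i k * \<delta> k) \<le> B t i k * cmod (\<delta> k)" for k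
      using \<delta>_stationary[of k] norm_J_le[of k i] by (cases "t k < s k") (auto simp: norm_mult mult_right_mono)
    from norm_\<delta>_le_aux[OF this] show "cmod (\<delta> i) - (t' i - t i)
        \<le> (\<Sum>k\<in>UNIV. B t i k * (cmod (\<delta> k) - (t' k - t k)))"
      using t'_eq[of i] by (simp add: right_diff_distrib sum_subtractf)
  qed
  then show ?thesis by simp
qed

lemma J_\<delta>_eq: "(\<Sum>k\<in>UNIV. J i k * \<delta> k) = (\<Sum>k\<in>UNIV. pd (a i) (Some k) (opt \<alpha> y) * \<delta> k)"
  by (intro sum.cong refl) (metis J_eq_pd \<delta>_stationary mult_zero_right)

lemma norm_J_\<delta>_le: "cmod (\<Sum>k\<in>UNIV. J i k * \<delta> k) \<le> (\<Sum>k\<in>UNIV. B t i k * (t' k - t k))"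
proof (rule sum_norm_le)
  fix k
  show "cmod (J i k * \<delta> k) \<le> B t i k * (t' k - t k)"
  proof (cases "t k < s k")
    case True
    then show ?thesis
      unfolding norm_mult by (intro mult_mono norm_J_le norm_\<delta>_le B_t_nonneg) auto
  next
    case False
    then show ?thesis using \<delta>_stationary[OF False] B_t_nonneg[of i k] t_bounds(4)[of k] by simp
  qed
qed

lemma newton_succ_norm: "cmod (y i + \<delta> i) \<le> t' i"
  using norm_triangle_ineq[of "y i" "\<delta> i"] y[of i] norm_\<delta>_le[of i] by simp

text \<open>The equation for \<open>\<delta>\<close> turns the new residual into the second-order
  Taylor remainder at \<open>y\<close>. The real residual has the same form, and the real remainder
  majorizes the complex one.\<close>

lemma newton_succ_residual:
  "cmod (ps (a i) (opt \<alpha> (\<lambda>i. y i + \<delta> i)) - (y i + \<delta> i)) \<le> F t' i - t' i"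
proof -
  let ?z = "opt \<alpha> (\<lambda>i. y i + \<delta> i)"
  have "cmod (ps (a i) ?z - ps (a i) (opt \<alpha> y) - (\<Sum>x\<in>UNIV. pd (a i) x (opt \<alpha> y) * (?z x - opt \<alpha> y x)))
      \<le> ps (a i) (opt \<rho> t') - ps (a i) (opt \<rho> t) - (\<Sum>x\<in>UNIV. pd (a i) x (opt \<rho> t) * (opt \<rho> t' x - opt \<rho> t x))"
  proof (rule norm_ps_remainder_le[OF a])
    show "conv_at (a i) (opt \<rho> t')"
      using t' by (intro conv_le_\<sigma>) (auto simp: newton_state_def)
    show "cmod (?z x - opt \<alpha> y x) \<le> opt \<rho> t' x - opt \<rho> t x" for x
      using norm_\<delta>_le by (cases x) auto
  qed (rule t_conv)
  then have "cmod (ps (a i) ?z - ps (a i) (opt \<alpha> y) - (\<Sum>k\<in>UNIV. J i k * \<delta> k))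
      \<le> F t' i - F t i - (\<Sum>k\<in>UNIV. B t i k * (t' k - t k))"
    by (simp add: sum_UNIV_option J_\<delta>_eq B_def F_def)
  moreover have "ps (a i) ?z - ps (a i) (opt \<alpha> y) - (\<Sum>k\<in>UNIV. J i k * \<delta> k) = ps (a i) ?z - (y i + \<delta> i)"
    by (subst (2) \<delta>) simp
  moreover have "F t' i - F t i - (\<Sum>k\<in>UNIV. B t i k * (t' k - t k)) = F t' i - t' i"
    using t'_eq[of i] by simp
  ultimately show ?thesis by simp
qed

text \<open>The new iterate is the value of the system at \<open>y\<close> plus the linear term in
  \<open>\<delta>\<close>. The difference of the values at \<open>y\<close> and \<open>w\<close> and
  the linear term are majorized separately.\<close>

lemma newton_succ_picard:
  assumes w: "\<And>i. cmod (w i) \<le> v n i" "\<And>i. cmod (y i - w i) \<le> t i - v n i"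
  shows "cmod (y i + \<delta> i - ps (a i) (opt \<alpha> w)) \<le> t' i - v (Suc n) i"
proof -
  have "cmod (ps (a i) (opt \<alpha> y) - ps (a i) (opt \<alpha> w)) \<le> ps (a i) (opt \<rho> t) - ps (a i) (opt \<rho> (v n))"
  proof (rule norm_ps_diff_le[OF a])
    show "conv_at (a i) (opt \<rho> t)" using t_bounds by (intro conv_le_\<sigma>) auto
    show "cmod (opt \<alpha> w x) \<le> opt \<rho> (v n) x" for x using w \<alpha> by (cases x) auto
    show "cmod (opt \<alpha> y x - opt \<alpha> w x) \<le> opt \<rho> t x - opt \<rho> (v n) x" for x using w by (cases x) auto
  qed
  from norm_triangle_mono[OF this norm_J_\<delta>_le[of i]]
  have "cmod (ps (a i) (opt \<alpha> y) - ps (a i) (opt \<alpha> w) + (\<Sum>k\<in>UNIV. J i k * \<delta> k))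
      \<le> F t i - v (Suc n) i + (\<Sum>k\<in>UNIV. B t i k * (t' k - t k))"
    by (simp add: F_def vS)
  moreover have "ps (a i) (opt \<alpha> y) - ps (a i) (opt \<alpha> w) + (\<Sum>k\<in>UNIV. J i k * \<delta> k)
      = y i + \<delta> i - ps (a i) (opt \<alpha> w)"
    by (subst (2) \<delta>) simp
  moreover have "F t i - v (Suc n) i + (\<Sum>k\<in>UNIV. B t i k * (t' k - t k)) = t' i - v (Suc n) i"
    using t'_eq[of i] by simp
  ultimately show ?thesis by simp
qed

end

end

end

section \<open>Convergence of the Newton iteration\<close>

lemma egs_eq_ps: "egs F x = ps (ecoef F) x"
  by (simp add: egs_def ps_def egs_term_def mon_def egs_coeff_ecoef)

lemma egs_unit_eq_evf:
  assumes "nn_at (gfps F) r" "cmod z \<le> r"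
  shows "egs F (\<lambda>_. z) = evf (gfps F) z"
proof -
  have bij: "bij_betw (\<lambda>N (_::unit). N) (UNIV :: nat set) UNIV"
    by (rule bij_betwI[where g="\<lambda>n. n ()"]) (auto simp: fun_eq_iff)
  have "egs F (\<lambda>_. z) = (\<Sum>\<^sub>\<infinity>N. egs_term F (\<lambda>_. z) (\<lambda>_. N))"
    unfolding egs_def by (rule infsum_reindex_bij_betw[OF bij, symmetric])
  also have "\<dots> = (\<Sum>\<^sub>\<infinity>N. of_real (fps_nth (gfps F) N) * z ^ N)"
    by (simp add: egs_term_def egs_coeff_ecoef gfps_def)
  also have "\<dots> = evf (gfps F) z"
    by (rule infsumI[OF evf_has_sum[OF assms]])
  finally show ?thesis .
qed

lemma nn_at_gfps:
  assumes "ereal r < conv_radius (\<lambda>n. egs_coeff F (\<lambda>_. n))" "0 \<le> r"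
  shows "nn_at (gfps F) r"
proof -
  have "summable (\<lambda>n. norm (egs_coeff F (\<lambda>_. n) * complex_of_real r ^ n))"
    by (rule abs_summable_in_conv_radius) (use assms in simp)
  then show ?thesis
    using assms by (simp add: nn_at_def gfps_nonneg norm_mult norm_power egs_coeff_ecoef gfps_def ecoef_nonneg)
qed

lemma exists_larger_radius:
  fixes R :: "'m::finite \<Rightarrow> ereal"
  assumes "\<And>i. ereal r < R i"
  shows "\<exists>r'>r. \<forall>i. ereal r' < R i"
proof -
  have "ereal r < Min (range R)" using assms by (subst Min_gr_iff) auto
  then obtain r' where "ereal r < ereal r'" "ereal r' < Min (range R)" using ereal_dense2 by blast
  then show ?thesis by (intro exI[of _ r']) (auto simp: Min_gr_iff)
qed

text \<open>A single positive coefficient of positive degree would make the value strictly larger at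
  the larger radius.\<close>

lemma evf_mono_point:
  assumes f: "nn_at f r'" and r: "0 \<le> r" "r < r'"
  shows "evf f r \<le> evf f r'" "evf f r = evf f r' \<Longrightarrow> N \<noteq> 0 \<Longrightarrow> fps_nth f N = 0"
proof -
  have r1: "((\<lambda>N. fps_nth f N * r ^ N) has_sum evf f r) UNIV"
    using evf_has_sum[OF f, of r] r by simp
  have r2: "((\<lambda>N. fps_nth f N * r' ^ N) has_sum evf f r') UNIV"
    using evf_has_sum[OF f, of r'] r by simp
  have le: "fps_nth f N * r ^ N \<le> fps_nth f N * r' ^ N" for N
    using f r by (intro mult_left_mono power_mono) (auto simp: nn_at_def)
  show "evf f r \<le> evf f r'" by (rule has_sum_mono[OF r1 r2 le])
  show "fps_nth f N = 0" if "evf f r = evf f r'" "N \<noteq> 0"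
  proof (rule ccontr)
    assume "fps_nth f N \<noteq> 0"
    then have "0 < fps_nth f N" using f by (simp add: nn_at_def less_le)
    moreover have "r ^ N < r' ^ N" using r that(2) by (intro power_strict_mono) auto
    ultimately have lt: "fps_nth f N * r ^ N < fps_nth f N * r' ^ N" by (rule mult_strict_left_mono[rotated])
    have "evf f r < evf f r'"
      by (rule has_sum_strict_mono[OF r1 r2, where x=N]) (rule le UNIV_I lt)+
    then show False using that(1) by simp
  qed
qed

text \<open>Invertibility at every step is asserted as well because \<open>matrix_inv\<close> of a
  singular matrix would be an arbitrary value.\<close>

theorem mainTheorem15:
  fixes H :: "'m::finite \<Rightarrow> ('m option, 'x) species"
    and S :: "'m \<Rightarrow> (unit, 'y) species"
    and \<alpha> :: complex
  assumes "well_founded_system H S"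
    and "\<forall>i. analytic_species (H i)"
    and "\<forall>i. ereal (cmod \<alpha>) < conv_radius (\<lambda>n. egs_coeff (S i) (\<lambda>_. n))"
  shows "(\<forall>n. invertible (mat 1 - system_jacobian H \<alpha> (newton H \<alpha> n))) \<and>
         newton H \<alpha> \<longlonglongrightarrow> (\<chi> i. egs (S i) (\<lambda>_. \<alpha>))"
proof -
  obtain Y where H: "\<And>i. is_species (H i)" and S: "\<And>i. is_species (S i)" and Y: "system_iteration H Y"
    and conv: "\<And>p. eventually (\<lambda>n. \<forall>i. species_iso_upto p (Y n i) (S i)) sequentially"
    and nonempty: "\<And>i. \<not> empty_species (S i)"
    using assms(1) unfolding well_founded_system_def by blast
  define \<rho> where "\<rho> = cmod \<alpha>"
  obtain \<rho>' where \<rho>': "\<rho> < \<rho>'" and rad: "\<And>i. ereal \<rho>' < conv_radius (\<lambda>n. egs_coeff (S i) (\<lambda>_. n))"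
    using exists_larger_radius[of \<rho> "\<lambda>i. conv_radius (\<lambda>n. egs_coeff (S i) (\<lambda>_. n))"] assms(3)
    by (auto simp: \<rho>_def)
  have "0 \<le> \<rho>" by (simp add: \<rho>_def)
  with \<rho>' have \<rho>0: "0 \<le> \<rho>" "0 \<le> \<rho>'" "0 < \<rho>'" by auto
  have nnS: "nn_at (gfps (S i)) \<rho>'" for i by (rule nn_at_gfps[OF rad \<rho>0(2)])
  have nnY: "nn_at (gfps (Y n i)) \<rho>'" for n i by (rule nn_at_iterate[OF H Y conv nnS \<rho>0(2)])
  note eval = iterate_eval[OF H Y conv nnS]
  note tends = iterate_tendsto[OF H Y conv nnS]
  have conv_real: "conv_at (ecoef (H i)) (opt x (\<lambda>j. evf (gfps (Y n j)) x))"
    if x: "0 \<le> x" "x \<le> \<rho>'" for i n and x :: real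
  proof -
    have "(\<lambda>m. of_real (ecoef (H i) m) * mon (opt x (\<lambda>j. evf (gfps (Y n j)) x)) m) summable_on UNIV"
      using eval[of x i n] x by (intro has_sum_imp_summable) auto
    moreover have "0 \<le> opt x (\<lambda>j. evf (gfps (Y n j)) x) k" for k
      using x by (intro opt_nonneg evf_nonneg[OF nnY])
    ultimately show ?thesis by (simp add: conv_at_def ecoef_nonneg)
  qed
  have ps_iterate: "evf (gfps (Y (Suc n) i)) z = ps (ecoef (H i)) (opt z (\<lambda>j. evf (gfps (Y n j)) z))"
    if "norm z \<le> \<rho>'" for n i and z :: "'b::{banach,real_normed_field}"
    unfolding ps_def by (rule infsumI[symmetric, OF eval[OF that]])
  have zero: "evf (gfps (Y 0 i)) z = 0" for i and z :: "'b::{banach,real_normed_field}"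
    by (simp add: gfps_iterate_0[OF H Y conv] evf_def)
  interpret majorized_newton "\<lambda>i. ecoef (H i)" \<rho> \<rho>' "\<lambda>n i. evf (gfps (Y n i)) \<rho>'"
    "\<lambda>n i. evf (gfps (Y n i)) \<rho>" "\<lambda>i. evf (gfps (S i)) \<rho>'" "\<lambda>i. evf (gfps (S i)) \<rho>"
  proof
    show "0 \<le> ecoef (H i) n" for i n by (rule ecoef_nonneg)
    show "0 \<le> \<rho>" "\<rho> < \<rho>'" by (fact \<rho>0 \<rho>')+
    show "evf (gfps (Y 0 i)) \<rho>' = 0" "evf (gfps (Y 0 i)) \<rho> = 0" for i by (rule zero)+
    show "evf (gfps (Y (Suc n) i)) \<rho>' = ps (ecoef (H i)) (opt \<rho>' (\<lambda>i. evf (gfps (Y n i)) \<rho>'))" for n i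
      using \<rho>0 by (intro ps_iterate) simp
    show "evf (gfps (Y (Suc n) i)) \<rho> = ps (ecoef (H i)) (opt \<rho> (\<lambda>i. evf (gfps (Y n i)) \<rho>))" for n i
      using \<rho>0 \<rho>' by (intro ps_iterate) simp
    show "conv_at (ecoef (H i)) (opt \<rho>' (\<lambda>i. evf (gfps (Y n i)) \<rho>'))"
      "conv_at (ecoef (H i)) (opt \<rho> (\<lambda>i. evf (gfps (Y n i)) \<rho>))" for n i
      using \<rho>0 \<rho>' by (intro conv_real; simp)+
    show "(\<lambda>n. evf (gfps (Y n i)) \<rho>') \<longlonglongrightarrow> evf (gfps (S i)) \<rho>'"
      "(\<lambda>n. evf (gfps (Y n i)) \<rho>) \<longlonglongrightarrow> evf (gfps (S i)) \<rho>" for i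
      using \<rho>0 \<rho>' by (intro tends; simp)+
    \<comment> \<open>A structure of \<open>S i\<close> on some finite set gives a positive
      coefficient, and its term is positive since \<open>\<rho>' > 0\<close>, also for
      \<open>\<alpha> = 0\<close>.\<close>
    show "0 < evf (gfps (S i)) \<rho>'" for i
    proof -
      obtain U where U: "fin_tuple U" "structs (S i) U \<noteq> {}"
        using nonempty[of i] by (auto simp: empty_species_def)
      define B where "B = U ()"
      have UB: "U = (\<lambda>_. B)" by (simp add: fun_eq_iff B_def)
      have "finite B" using U by (simp add: fin_tuple_def B_def)
      have "0 < real (card (structs (S i) (\<lambda>_. B)))"
        using U finite_structs[OF S U(1)] unfolding UB by (simp add: card_gt_0_iff)
      then have c: "0 < fps_nth (gfps (S i)) (card B)"
        using card_structs_gfps[OF S \<open>finite B\<close>] by (simp add: zero_less_mult_iff)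
      have sum: "((\<lambda>N. fps_nth (gfps (S i)) N * \<rho>' ^ N) has_sum evf (gfps (S i)) \<rho>') UNIV"
        using evf_has_sum[OF nnS, of \<rho>' i] \<rho>0 by simp
      have lt: "0 < fps_nth (gfps (S i)) (card B) * \<rho>' ^ card B" using c \<rho>0 by simp
      show ?thesis
        by (rule has_sum_strict_mono[OF has_sum_0_simp sum, where x="card B"])
          (use \<rho>0 lt in \<open>auto intro!: mult_nonneg_nonneg gfps_nonneg\<close>)
    qed
    show "evf (gfps (S i)) \<rho> \<le> evf (gfps (S i)) \<rho>'" for i
      by (rule evf_mono_point[OF nnS \<rho>0(1) \<rho>'])
    \<comment> \<open>Equal values at both radii make the series of \<open>S i\<close> constant.
      Once the constant coefficient of \<open>Y n i\<close> is right, so are all others, which lie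
      between \<open>0\<close> and those of \<open>S i\<close>.\<close>
    show "\<exists>n. evf (gfps (Y n i)) \<rho>' = evf (gfps (S i)) \<rho>'" if "evf (gfps (S i)) \<rho> = evf (gfps (S i)) \<rho>'" for i
    proof -
      have "eventually (\<lambda>n. fps_nth (gfps (Y n i)) 0 = fps_nth (gfps (S i)) 0) sequentially"
        by (rule gfps_iterate_eventually[OF H Y conv])
      then obtain n where n: "fps_nth (gfps (Y n i)) 0 = fps_nth (gfps (S i)) 0"
        unfolding eventually_sequentially by blast
      have "fps_nth (gfps (Y n i)) N = fps_nth (gfps (S i)) N" for N
      proof (cases "N = 0")
        case False
        have "fps_nth (gfps (S i)) N = 0"
          by (rule evf_mono_point(2)[OF nnS \<rho>0(1) \<rho>' that False])
        then show ?thesis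
          using gfps_iterate_le[OF H Y conv, of n i N] gfps_nonneg[of "Y n i" N] by simp
      qed (simp add: n)
      then have "gfps (Y n i) = gfps (S i)" by (rule fps_ext)
      then show ?thesis by (intro exI[of _ n]) simp
    qed
  qed
  obtain t where t0: "t 0 = (\<lambda>i. 0)" and t: "\<And>n. newton_state (t n)" "\<And>n. newton_succ (t n) (t (Suc n))"
    using real_newton_exists by blast
  define y where "y n i = newton H \<alpha> n $ i" for n i
  define J where "J n i k = system_jacobian H \<alpha> (newton H \<alpha> n) $ i $ k" for n i k
  let ?w = "\<lambda>n i. evf (gfps (Y n i)) \<alpha>" and ?v = "\<lambda>n i. evf (gfps (Y n i)) \<rho>"
  have \<alpha>\<rho>': "cmod \<alpha> \<le> \<rho>'" using \<rho>' by (simp add: \<rho>_def)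
  have w_le: "cmod (?w n i) \<le> ?v n i" for n i
    unfolding \<rho>_def by (rule norm_evf_le[OF nnY \<alpha>\<rho>'])
  have F_y: "system_egs H \<alpha> (newton H \<alpha> n) $ i = ps (ecoef (H i)) (opt \<alpha> (y n))" for n i
    by (simp add: system_egs_def egs_eq_ps y_def[abs_def])
  have J: "J n i k = deriv (\<lambda>z. ps (ecoef (H i)) (opt \<alpha> ((y n)(k := z)))) (y n k)" for n i k
  proof -
    have "opt \<alpha> (\<lambda>j. if j = k then z else newton H \<alpha> n $ j) = opt \<alpha> ((y n)(k := z))" for z
      by (rule arg_cong[where f="opt \<alpha>"]) (auto simp: y_def)
    then show ?thesis by (simp add: J_def system_jacobian_def system_egs_def egs_eq_ps y_def)
  qed
  \<comment> \<open>The invariant majorizes size, residual and distance to the Picard iterate. The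
    first two make the next step possible, the third yields the limit.\<close>
  define bounded where "bounded n \<longleftrightarrow> (\<forall>i. cmod (y n i) \<le> t n i \<and>
      cmod (ps (ecoef (H i)) (opt \<alpha> (y n)) - y n i) \<le> F (t n) i - t n i \<and>
      cmod (y n i - ?w n i) \<le> t n i - ?v n i)" for n
  have inv: "invertible (mat 1 - system_jacobian H \<alpha> (newton H \<alpha> n))" if "bounded n" for n
  proof (rule invertible_mat_minus)
    fix x i
    assume x: "\<And>i. x i = (\<Sum>k\<in>UNIV. system_jacobian H \<alpha> (newton H \<alpha> n) $ i $ k * x k)"
    have yt: "cmod (y n i) \<le> t n i" for i using that unfolding bounded_def by blast
    show "x i = 0"
      by (rule J_injective[OF \<rho>_def[symmetric] t(1) t(1) t(2) yt J]) (rule x[folded J_def])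
  qed
  have bounded: "bounded n" for n
  proof (induction n)
    case 0
    have y0: "y 0 = (\<lambda>i. 0)" by (simp add: y_def fun_eq_iff)
    \<comment> \<open>At the starting point \<open>0\<close> the residual is the first Picard
      iterate, both at \<open>\<alpha>\<close> and at \<open>\<rho>\<close>.\<close>
    have "cmod (?w 1 i) \<le> ?v 1 i" for i by (rule w_le)
    moreover have "?w 1 i = ps (ecoef (H i)) (opt \<alpha> (\<lambda>i. 0))" for i
      using ps_iterate[OF \<alpha>\<rho>', of 0 i] by (simp add: zero)
    moreover have "?v 1 i = F (\<lambda>i. 0) i" for i
      using ps_iterate[of \<rho> 0 i] \<rho>0 \<rho>' by (simp add: zero F_def)
    ultimately show ?case by (simp add: bounded_def y0 t0 zero)
  next
    case (Suc n)
    define \<delta> where "\<delta> i = (matrix_inv (mat 1 - system_jacobian H \<alpha> (newton H \<alpha> n)) *v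
       (system_egs H \<alpha> (newton H \<alpha> n) - newton H \<alpha> n)) $ i" for i
    have \<delta>: "\<delta> i = (\<Sum>k\<in>UNIV. J n i k * \<delta> k) + (ps (ecoef (H i)) (opt \<alpha> (y n)) - y n i)" for i
      using matrix_inv_mat_minus_step[OF inv[OF Suc] refl,
          where r="system_egs H \<alpha> (newton H \<alpha> n) - newton H \<alpha> n" and i=i]
      unfolding \<delta>_def J_def vector_minus_component F_y y_def .
    have ySuc: "y (Suc n) = (\<lambda>i. y n i + \<delta> i)"
      by (simp add: y_def \<delta>_def fun_eq_iff)
    have b: "cmod (y n i) \<le> t n i" "cmod (ps (ecoef (H i)) (opt \<alpha> (y n)) - y n i) \<le> F (t n) i - t n i"
      "cmod (y n i - ?w n i) \<le> t n i - ?v n i" for i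
      using Suc unfolding bounded_def by blast+
    note step = \<rho>_def[symmetric] t(1) t(1) t(2) b(1) J \<delta> b(2)
    show ?case
      unfolding bounded_def ySuc
    proof (intro allI conjI)
      fix i
      show "cmod (y n i + \<delta> i) \<le> t (Suc n) i" by (rule newton_succ_norm[OF step])
      show "cmod (ps (ecoef (H i)) (opt \<alpha> (\<lambda>i. y n i + \<delta> i)) - (y n i + \<delta> i)) \<le> F (t (Suc n)) i - t (Suc n) i"
        by (rule newton_succ_residual[OF step])
      show "cmod (y n i + \<delta> i - ?w (Suc n) i) \<le> t (Suc n) i - ?v (Suc n) i"
        unfolding ps_iterate[OF \<alpha>\<rho>'] by (rule newton_succ_picard[OF step w_le b(3)])
    qed
  qed
  have "(\<lambda>n. newton H \<alpha> n $ i) \<longlonglongrightarrow> evf (gfps (S i)) \<alpha>" for i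
  proof -
    \<comment> \<open>The distance is at most \<open>t n i - ?v n i\<close>, and
      \<open>t n i\<close> stays below the limit of \<open>?v n i\<close>, so the error of the
      Picard iteration at \<open>\<rho>\<close> bounds it.\<close>
    have "(\<lambda>n. y n i - ?w n i) \<longlonglongrightarrow> 0"
    proof (rule Lim_null_comparison)
      have "cmod (y n i - ?w n i) \<le> evf (gfps (S i)) \<rho> - ?v n i" for n
      proof -
        have "cmod (y n i - ?w n i) \<le> t n i - ?v n i" using bounded[of n] unfolding bounded_def by blast
        moreover have "t n i \<le> evf (gfps (S i)) \<rho>" using t(1)[of n] unfolding newton_state_def by blast
        ultimately show ?thesis by linarith
      qed
      then show "\<forall>\<^sub>F n in sequentially. norm (y n i - ?w n i) \<le> evf (gfps (S i)) \<rho> - ?v n i"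
        by (intro always_eventually allI)
      have "(\<lambda>n. evf (gfps (S i)) \<rho> - ?v n i) \<longlonglongrightarrow> evf (gfps (S i)) \<rho> - evf (gfps (S i)) \<rho>"
        using \<rho>0 \<rho>' by (intro tendsto_diff tendsto_const tends) simp
      then show "(\<lambda>n. evf (gfps (S i)) \<rho> - ?v n i) \<longlonglongrightarrow> 0" by simp
    qed
    from tendsto_add[OF this tends[OF \<alpha>\<rho>', of i]] show ?thesis by (simp add: y_def)
  qed
  then have "newton H \<alpha> \<longlonglongrightarrow> (\<chi> i. egs (S i) (\<lambda>_. \<alpha>))"
    by (intro vec_tendstoI) (simp add: egs_unit_eq_evf[OF nnS \<alpha>\<rho>'])
  then show ?thesis using inv bounded by blast
qed

end
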